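(* Let $(\mathcal{P},\overline{E})$ be a radical curve parametrization with $\overline{E}=(E_1,\ldots,E_m)$ and $$\mathcal{P}(t,\overline{\Delta})=\left(\frac{p_1(t,\overline{\Delta})}{q_1(t,\overline{\Delta})},\ldots,\frac{p_n(t,\overline{\Delta})}{q_n(t,\overline{\Delta})}\right),\qquad p_i,q_i\in\mathbb{C}[t,\overline{\Delta}],$$ such that $N(p_i)=p_i$ and $N(q_i)=q_i$ for all $i=1,\ldots,n$. Suppose that: 1. there exists $i\in\{1,\ldots,n\}$ such that $p_i$ is not guilty and $\deg p_i>\deg q_i$; 2. for all $i\in\{1,\ldots,n\}$, the ideal $I_i(\mathcal{P}):=\langle E_1,\ldots,E_m,p_i,q_i\rangle$ is the whole ring $\mathbb{C}[t,\overline{\Delta}]$. Then the parametrization is surjective.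
   Context: **Radical curve parametrization.** Let $\mathbb{F}_0=\mathbb{C}(t)\subseteq\mathbb{F}_1\subseteq\cdots\subseteq\mathbb{F}_m$ be a radical tower: $\mathbb{F}_i=\mathbb{F}_{i-1}(\delta_i)$ with $\delta_i^{e_i}\in\mathbb{F}_{i-1}$, $e_i$ a positive integer. Write $\overline{\delta}=(\delta_1,\ldots,\delta_m)$ and $\overline{\Delta}=(\Delta_1,\ldots,\Delta_m)$ for corresponding variables. The defining polynomials of the $\delta_i$ are $E_i=\Delta_i^{e_i}-g_i(t,\Delta_1,\ldots,\Delta_{i-1})\in\mathbb{C}[t,\overline{\Delta}]$, where $g_i$ is a nonzero polynomial with $\deg_{\Delta_j}(g_i)<e_j$ for $j<i$, and $E_i(t,\overline{\delta})=0$. A radical curve parametrization is given by a tuple $\mathcal{P}(t,\overline{\Delta})=(p_1/q_1,\ldots,p_n/q_n)$ with $p_i,q_i\in\mathbb{C}[t,\overline{\Delta}]$, $q_i(t,\overline{\delta})\neq 0$, together with $\overline{E}=(E_1,\ldots,E_m)$, where the elements $x_i=p_i(t,\overline{\delta})/q_i(t,\overline{\delta})\in\mathbb{F}_m$ are not all constant (the Jacobian with respect to $t$ has rank one). **Surjective.** Let $X(\mathcal{P})\subseteq\mathbb{C}^n$ be the set of all $\overline{x}\in\mathbb{C}^n$ for which there is $(t,\overline{\Delta})\in\mathbb{C}^{m+1}$ such that $E_i(t,\overline{\Delta})=0$ for all $i=1,\ldots,m$, $\mathcal{P}(t,\overline{\Delta})$ is well defined (i.e. $q_i(t,\overline{\Delta})\ne0$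 for all $i$), and $\mathcal{P}(t,\overline{\Delta})=\overline{x}$. The parametrization is surjective when $X(\mathcal{P})$ is Zariski closed in $\mathbb{C}^n$. **Weighted degree.** $\deg$ on $\mathbb{C}[t,\overline{\Delta}]$ is the weighted degree with rational weights given by $\deg(t)=1$ and, recursively, $\deg(\Delta_i)=\deg(g_i)/e_i$ (and $\deg 0=-\infty$). **Normal form.** $N(f)$ is the normal form of $f\in\mathbb{C}[t,\overline{\Delta}]$ with respect to $\{E_1,\ldots,E_m\}$ (a Gröbner basis for the lexicographic order $\Delta_m>\cdots>\Delta_1>t$), i.e. the polynomial obtained by repeatedly substituting every instance of $\Delta_i^{e_i}$ by $g_i$. Thus $N(f)=f$ means $\deg_{\Delta_i}(f)<e_i$ for all $i$. **$R(f)$ and guilty.** Let $\gamma_k=\exp(2\pi \mathrm{i}/e_k)$. For $f\in\mathbb{C}[t,\overline{\Delta}]$ put $f_m=f$ and recursively, for $k=m,\ldots,1$, $$F_k=\prod_{j=1}^{e_k} f_k(t,\Delta_1,\ldots,\Delta_{k-1},\gamma_k^j\Delta_k),\qquad f_{k-1}=\mathrm{rem}(F_k,E_k),$$ the remainder of the division of $F_k$ by $E_k$ with respect to $\Delta_k$; one has $f_{k-1}\in\mathbb{C}[t,\Delta_1,\ldots,\Delta_{k-1}]$. Set $R(f)=f_0\in\mathbb{C}[t]$. The polynomial $f$ is guilty when $\deg(f)\cdot e_1\cdots e_m>\deg(R(f))$. *)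

theory Defs
  imports
    "HOL-Analysis.Analysis"
    "HOL-Library.Poly_Mapping"
    "HOL-Computational_Algebra.Fraction_Field"
    "HOL-Computational_Algebra.Polynomial"
begin

text \<open>
  The variables are indexed by \<open>'v\<close>. For \<open>'v = nat\<close> the variable with index \<open>0\<close> is \<open>t\<close> and the
  variable with index \<open>i \<ge> 1\<close> is \<open>\<Delta>\<^sub>i\<close>; since the type has infinitely many variables, the ring
  \<open>\<complex>[t, \<Delta>\<^sub>1, \<dots>, \<Delta>\<^sub>k]\<close> is the subring \<open>poly_ring k\<close> below.
\<close>

type_synonym 'v mpoly = "('v \<Rightarrow>\<^sub>0 nat) \<Rightarrow>\<^sub>0 complex"

definition Const :: "complex \<Rightarrow> 'v mpoly" where
  "Const c = Poly_Mapping.single 0 c"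

definition Var :: "'v \<Rightarrow> 'v mpoly" where
  "Var i = Poly_Mapping.single (Poly_Mapping.single i 1) 1"

definition vars :: "'v mpoly \<Rightarrow> 'v set" where
  "vars f = (\<Union>a\<in>Poly_Mapping.keys f. Poly_Mapping.keys a)"

definition poly_ring :: "nat \<Rightarrow> nat mpoly set" where
  "poly_ring k = {f. vars f \<subseteq> {..k}}"

text \<open>
  \<open>eval_poly \<phi> x f\<close> maps the coefficients of \<open>f\<close> by \<open>\<phi>\<close> and substitutes \<open>x i\<close> for the
  \<open>i\<close>-th variable. It serves for points of affine space (\<open>\<phi> = id\<close>), for elements of a field
  extension of \<open>\<complex>\<close>, and for substitution of polynomials (\<open>\<phi> = Const\<close>).
\<close>

definition eval_poly :: "(complex \<Rightarrow> 'a::comm_semiring_1) \<Rightarrow> ('v \<Rightarrow> 'a) \<Rightarrow> 'v mpoly \<Rightarrow> 'a" where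
  "eval_poly \<phi> x f =
     (\<Sum>a\<in>Poly_Mapping.keys f.
        \<phi> (Poly_Mapping.lookup f a) * (\<Prod>i\<in>Poly_Mapping.keys a. x i ^ Poly_Mapping.lookup a i))"

text \<open>Convention: the zero polynomial has \<open>var_deg\<close> zero.\<close>

definition var_deg :: "'v \<Rightarrow> 'v mpoly \<Rightarrow> nat" where
  "var_deg i f = Max (insert 0 ((\<lambda>a. Poly_Mapping.lookup a i) ` Poly_Mapping.keys f))"

definition ideal_gen :: "'a::comm_ring_1 set \<Rightarrow> 'a set \<Rightarrow> 'a set" where
  "ideal_gen A S = {(\<Sum>s\<in>T. c s * s) | T c. finite T \<and> T \<subseteq> S \<and> (\<forall>s\<in>T. c s \<in> A)}"

definition zariski_closed :: "(complex^'n::finite) set \<Rightarrow> bool" where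
  "zariski_closed X \<longleftrightarrow> (\<exists>S :: 'n mpoly set. X = {x. \<forall>f\<in>S. eval_poly id (vec_nth x) f = 0})"

definition is_subfield :: "'a::field set \<Rightarrow> bool" where
  "is_subfield L \<longleftrightarrow>
     1 \<in> L \<and> (\<forall>x\<in>L. \<forall>y\<in>L. x - y \<in> L \<and> x * y \<in> L) \<and> (\<forall>x\<in>L. inverse x \<in> L)"

definition adjoin :: "'a::field set \<Rightarrow> 'a \<Rightarrow> 'a set" where
  "adjoin K x = \<Inter>{L. is_subfield L \<and> K \<subseteq> L \<and> x \<in> L}"

definition is_field_hom :: "('a::field \<Rightarrow> 'b::field) \<Rightarrow> bool" where
  "is_field_hom h \<longleftrightarrow>
     h 1 = 1 \<and> (\<forall>x y. h (x + y) = h x + h y) \<and> (\<forall>x y. h (x * y) = h x * h y)"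

text \<open>
  \<open>\<kappa>\<close> embeds \<open>\<complex>(t)\<close> into an ambient field, in which all the fields of the tower live;
  \<open>t\<close> itself is \<open>\<kappa> (Fract [:0, 1:] 1)\<close>.
\<close>

definition radical_tower ::
  "(complex poly fract \<Rightarrow> 'a::field) \<Rightarrow> nat \<Rightarrow> (nat \<Rightarrow> 'a set) \<Rightarrow> (nat \<Rightarrow> 'a) \<Rightarrow> (nat \<Rightarrow> nat) \<Rightarrow> bool"
where
  "radical_tower \<kappa> m F \<delta> e \<longleftrightarrow>
     is_field_hom \<kappa> \<and> F 0 = range \<kappa> \<and>
     (\<forall>i\<in>{1..m}. F i = adjoin (F (i - 1)) (\<delta> i) \<and> e i > 0 \<and> \<delta> i ^ e i \<in> F (i - 1))"

definition embed_const :: "(complex poly fract \<Rightarrow> 'a::field) \<Rightarrow> complex \<Rightarrow> 'a" where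
  "embed_const \<kappa> c = \<kappa> (Fract [:c:] 1)"

definition tower_eval :: "(complex poly fract \<Rightarrow> 'a::field) \<Rightarrow> (nat \<Rightarrow> 'a) \<Rightarrow> nat mpoly \<Rightarrow> 'a" where
  "tower_eval \<kappa> \<delta> = eval_poly (embed_const \<kappa>) (\<delta>(0 := \<kappa> (Fract [:0, 1:] 1)))"

definition E_poly :: "(nat \<Rightarrow> nat) \<Rightarrow> (nat \<Rightarrow> nat mpoly) \<Rightarrow> nat \<Rightarrow> nat mpoly" where
  "E_poly e g i = Var i ^ e i - g i"

definition radical_curve_parametrization ::
  "(complex poly fract \<Rightarrow> 'a::field) \<Rightarrow> nat \<Rightarrow> (nat \<Rightarrow> 'a set) \<Rightarrow> (nat \<Rightarrow> 'a) \<Rightarrow> (nat \<Rightarrow> nat) \<Rightarrow>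
   (nat \<Rightarrow> nat mpoly) \<Rightarrow> ('n::finite \<Rightarrow> nat mpoly) \<Rightarrow> ('n \<Rightarrow> nat mpoly) \<Rightarrow> bool"
where
  "radical_curve_parametrization \<kappa> m F \<delta> e g p q \<longleftrightarrow>
     radical_tower \<kappa> m F \<delta> e \<and>
     (\<forall>i\<in>{1..m}. g i \<noteq> 0 \<and> g i \<in> poly_ring (i - 1) \<and> (\<forall>j\<in>{1..<i}. var_deg j (g i) < e j) \<and>
        tower_eval \<kappa> \<delta> (E_poly e g i) = 0) \<and>
     (\<forall>i. p i \<in> poly_ring m \<and> q i \<in> poly_ring m \<and> tower_eval \<kappa> \<delta> (q i) \<noteq> 0) \<and>
     (\<exists>i. tower_eval \<kappa> \<delta> (p i) / tower_eval \<kappa> \<delta> (q i) \<notin> range (embed_const \<kappa>))"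

text \<open>
  A point \<open>(t, \<Delta>\<^sub>1, \<dots>, \<Delta>\<^sub>m)\<close> of \<open>\<complex>\<^bsup>m+1\<^esup>\<close> is given by a function \<open>a\<close> on the
  indices; its values beyond \<open>m\<close> are irrelevant, because all polynomials lie in \<open>poly_ring m\<close>.
\<close>

definition param_image ::
  "nat \<Rightarrow> (nat \<Rightarrow> nat) \<Rightarrow> (nat \<Rightarrow> nat mpoly) \<Rightarrow> ('n::finite \<Rightarrow> nat mpoly) \<Rightarrow> ('n \<Rightarrow> nat mpoly) \<Rightarrow>
   (complex^'n) set"
where
  "param_image m e g p q =
     {x. \<exists>a :: nat \<Rightarrow> complex.
        (\<forall>i\<in>{1..m}. eval_poly id a (E_poly e g i) = 0) \<and>
        (\<forall>i. eval_poly id a (q i) \<noteq> 0) \<and>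
        x = (\<chi> i. eval_poly id a (p i) / eval_poly id a (q i))}"

definition surjective_parametrization ::
  "nat \<Rightarrow> (nat \<Rightarrow> nat) \<Rightarrow> (nat \<Rightarrow> nat mpoly) \<Rightarrow> ('n::finite \<Rightarrow> nat mpoly) \<Rightarrow> ('n \<Rightarrow> nat mpoly) \<Rightarrow> bool"
where
  "surjective_parametrization m e g p q \<longleftrightarrow> zariski_closed (param_image m e g p q)"

text \<open>The supremum over the empty set of monomials gives \<open>weighted_deg w 0 = -\<infinity>\<close>.\<close>

definition weighted_deg :: "(nat \<Rightarrow> real) \<Rightarrow> nat mpoly \<Rightarrow> ereal" where
  "weighted_deg w f =
     (SUP a\<in>Poly_Mapping.keys f.
        ereal (\<Sum>i\<in>Poly_Mapping.keys a. w i * real (Poly_Mapping.lookup a i)))"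

text \<open>
  \<open>weights e g k\<close> are the weights of \<open>t, \<Delta>\<^sub>1, \<dots>, \<Delta>\<^sub>k\<close>; their values are rational. Passing to
  \<open>real_of_ereal\<close> is harmless because the \<open>g\<^sub>i\<close> are nonzero.
\<close>

primrec weights :: "(nat \<Rightarrow> nat) \<Rightarrow> (nat \<Rightarrow> nat mpoly) \<Rightarrow> nat \<Rightarrow> nat \<Rightarrow> real" where
  "weights e g 0 = (\<lambda>_. 0)(0 := 1)"
| "weights e g (Suc k) = (weights e g k)
     (Suc k := real_of_ereal (weighted_deg (weights e g k) (g (Suc k))) / real (e (Suc k)))"

definition deg :: "nat \<Rightarrow> (nat \<Rightarrow> nat) \<Rightarrow> (nat \<Rightarrow> nat mpoly) \<Rightarrow> nat mpoly \<Rightarrow> ereal" where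
  "deg m e g = weighted_deg (weights e g m)"

text \<open>
  The normal form with respect to the Groebner basis \<open>E\<^sub>1, \<dots>, E\<^sub>m\<close>: the representative modulo the
  ideal none of whose monomials is divisible by one of the leading monomials \<open>\<Delta>\<^sub>i\<^bsup>e\<^sub>i\<^esup>\<close>.
\<close>

definition is_normal_form ::
  "nat \<Rightarrow> (nat \<Rightarrow> nat) \<Rightarrow> (nat \<Rightarrow> nat mpoly) \<Rightarrow> nat mpoly \<Rightarrow> nat mpoly \<Rightarrow> bool"
where
  "is_normal_form m e g f r \<longleftrightarrow>
     r \<in> poly_ring m \<and> f - r \<in> ideal_gen (poly_ring m) (E_poly e g ` {1..m}) \<and>
     (\<forall>a\<in>Poly_Mapping.keys r. \<forall>i\<in>{1..m}. Poly_Mapping.lookup a i < e i)"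

definition normal_form ::
  "nat \<Rightarrow> (nat \<Rightarrow> nat) \<Rightarrow> (nat \<Rightarrow> nat mpoly) \<Rightarrow> nat mpoly \<Rightarrow> nat mpoly"
where
  "normal_form m e g f = (THE r. is_normal_form m e g f r)"

text \<open>
  The remainder is unique, as the divisors used below, \<open>E_poly e g k\<close>, are monic of positive
  degree in the \<open>k\<close>-th variable.
\<close>

definition is_var_rem :: "nat \<Rightarrow> nat mpoly \<Rightarrow> nat mpoly \<Rightarrow> nat mpoly \<Rightarrow> bool" where
  "is_var_rem k f d r \<longleftrightarrow> (\<exists>h. f = h * d + r) \<and> var_deg k r < var_deg k d"

definition var_rem :: "nat \<Rightarrow> nat mpoly \<Rightarrow> nat mpoly \<Rightarrow> nat mpoly" where
  "var_rem k f d = (THE r. is_var_rem k f d r)"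

definition conj_product :: "(nat \<Rightarrow> nat) \<Rightarrow> nat \<Rightarrow> nat mpoly \<Rightarrow> nat mpoly" where
  "conj_product e k f =
     (\<Prod>j\<in>{1..e k}.
        eval_poly Const (Var(k := Const (exp (2 * pi * \<i> / e k) ^ j) * Var k)) f)"

primrec R_poly :: "(nat \<Rightarrow> nat) \<Rightarrow> (nat \<Rightarrow> nat mpoly) \<Rightarrow> nat \<Rightarrow> nat mpoly \<Rightarrow> nat mpoly" where
  "R_poly e g 0 f = f"
| "R_poly e g (Suc k) f =
     R_poly e g k (var_rem (Suc k) (conj_product e (Suc k) f) (E_poly e g (Suc k)))"

definition guilty :: "nat \<Rightarrow> (nat \<Rightarrow> nat) \<Rightarrow> (nat \<Rightarrow> nat mpoly) \<Rightarrow> nat mpoly \<Rightarrow> bool" where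
  "guilty m e g f \<longleftrightarrow>
     deg m e g f * ereal (real (\<Prod>i\<in>{1..m}. e i)) > deg m e g (R_poly e g m f)"

end

theory Submission
  imports
    "Subresultants.Subresultant_Gcd"
    "HOL-Computational_Algebra.Field_as_Ring"
    "HOL-Computational_Algebra.Fundamental_Theorem_Algebra"
    Defs
begin

text \<open>
  Write \<open>V\<close> for the zero set of \<open>E\<^sub>1, \<dots>, E\<^sub>m\<close>. By the second hypothesis a point \<open>x\<close> is the image of
  \<open>a \<in> V\<close> iff \<open>p\<^sub>j(a) = x\<^sub>j q\<^sub>j(a)\<close> for all \<open>j\<close>. Since \<open>R(f)\<close> vanishes at \<open>t\<close> iff \<open>f\<close> vanishes
  somewhere on the finite fibre of \<open>V\<close> over \<open>t\<close>, this can be tested, with coordinates \<open>x\<^sub>j\<close> as additional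
  variables, by the polynomials \<open>R(\<Sum>\<^sub>j \<lambda>\<^sub>j (p\<^sub>j - x\<^sub>j q\<^sub>j))\<close> in \<open>t\<close> and \<open>x\<close>: the image is the projection
  along \<open>t\<close> of their common zero set. One of them, \<open>R(p\<^sub>i - x\<^sub>i q\<^sub>i)\<close> with \<open>i\<close> as in the first
  hypothesis, has a constant leading coefficient in \<open>t\<close>: give \<open>x\<^sub>i\<close> the weight
  \<open>deg p\<^sub>i - deg q\<^sub>i > 0\<close>; then \<open>R\<close> has weighted degree at most \<open>deg p\<^sub>i \<cdot> e\<^sub>1 \<cdots> e\<^sub>m\<close>, and as
  \<open>p\<^sub>i\<close> is not guilty this is attained by a power of \<open>t\<close> alone. So the projection is cut out by
  resultants with respect to \<open>t\<close>. It suffices to take \<open>\<lambda>\<^sub>j = s\<^bsup>n\<^sub>j\<^esup>\<close> with distinct \<open>n\<^sub>j\<close>,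
  because only finitely many points of \<open>V\<close> lie over the roots of \<open>R(p\<^sub>i - x\<^sub>i q\<^sub>i)\<close>.
\<close>

subsection \<open>Evaluation of polynomials\<close>

lemma poly_mapping_sum_single:
  "f = (\<Sum>a\<in>Poly_Mapping.keys f. Poly_Mapping.single a (Poly_Mapping.lookup f a))"
  by (rule poly_mapping_eqI)
     (auto simp: lookup_sum lookup_single when_def in_keys_iff)

lemma keys_add_nat:
  fixes a b :: "'v \<Rightarrow>\<^sub>0 nat"
  shows "Poly_Mapping.keys (a + b) = Poly_Mapping.keys a \<union> Poly_Mapping.keys b"
  by (auto simp: in_keys_iff lookup_add)

lemma Const_eq_0_iff [simp]: "Const c = 0 \<longleftrightarrow> c = 0"
  unfolding Const_def by (metis lookup_single_eq lookup_zero single_zero)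

lemma Const_hom: "comm_ring_hom Const"
  by unfold_locales (auto simp: Const_def single_add mult_single)

lemma id_hom: "comm_ring_hom (id :: 'a::comm_ring_1 \<Rightarrow> 'a)"
  by unfold_locales auto

lemma Var_power: "Var i ^ n = Poly_Mapping.single (Poly_Mapping.single i n) 1"
  by (induction n) (auto simp: Var_def mult_single simp flip: single_add)

definition monom_eval :: "('v \<Rightarrow> 'a::comm_semiring_1) \<Rightarrow> ('v \<Rightarrow>\<^sub>0 nat) \<Rightarrow> 'a" where
  "monom_eval x a = (\<Prod>i\<in>Poly_Mapping.keys a. x i ^ Poly_Mapping.lookup a i)"

lemma monom_eval_superset:
  assumes "finite A" "Poly_Mapping.keys a \<subseteq> A"
  shows "monom_eval x a = (\<Prod>i\<in>A. x i ^ Poly_Mapping.lookup a i)"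
  unfolding monom_eval_def using assms
  by (intro prod.mono_neutral_left) (auto simp: in_keys_iff)

lemma monom_eval_add: "monom_eval x (a + b) = monom_eval x a * monom_eval x b"
proof -
  let ?A = "Poly_Mapping.keys a \<union> Poly_Mapping.keys b"
  have "monom_eval x (a + b) = (\<Prod>i\<in>?A. x i ^ Poly_Mapping.lookup (a + b) i)"
    by (rule monom_eval_superset) (auto simp: keys_add_nat)
  also have "\<dots> = monom_eval x a * monom_eval x b"
    by (simp add: lookup_add power_add prod.distrib monom_eval_superset[of ?A])
  finally show ?thesis .
qed

lemma monom_eval_0 [simp]: "monom_eval x 0 = 1"
  by (simp add: monom_eval_def)

lemma monom_eval_single: "monom_eval x (Poly_Mapping.single i n) = x i ^ n"
  by (simp add: monom_eval_def)

lemma monom_eval_Var: "monom_eval Var a = Poly_Mapping.single a 1"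
proof -
  have *: "(\<Prod>i\<in>A. Var i ^ Poly_Mapping.lookup a i) =
      Poly_Mapping.single (\<Sum>i\<in>A. Poly_Mapping.single i (Poly_Mapping.lookup a i)) 1"
    if "finite A" for A
    using that by induction (auto simp: Var_power mult_single)
  show ?thesis
    unfolding monom_eval_def by (subst *) (simp_all flip: poly_mapping_sum_single)
qed

lemma eval_poly_monom_eval:
  "eval_poly \<phi> x f = (\<Sum>a\<in>Poly_Mapping.keys f. \<phi> (Poly_Mapping.lookup f a) * monom_eval x a)"
  by (simp add: eval_poly_def monom_eval_def)

context
  fixes \<phi> :: "complex \<Rightarrow> 'a::comm_ring_1"
  assumes hom: "comm_ring_hom \<phi>"
begin

interpretation comm_ring_hom \<phi> by (rule hom)

lemma eval_poly_superset:
  assumes "finite A" "Poly_Mapping.keys f \<subseteq> A"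
  shows "eval_poly \<phi> x f = (\<Sum>a\<in>A. \<phi> (Poly_Mapping.lookup f a) * monom_eval x a)"
  unfolding eval_poly_monom_eval using assms
  by (intro sum.mono_neutral_left) (auto simp: in_keys_iff)

lemma eval_poly_add: "eval_poly \<phi> x (f + g) = eval_poly \<phi> x f + eval_poly \<phi> x g"
proof -
  let ?A = "Poly_Mapping.keys f \<union> Poly_Mapping.keys g"
  have "Poly_Mapping.keys (f + g) \<subseteq> ?A" by (rule keys_add)
  then show ?thesis
    by (simp add: eval_poly_superset[of ?A] lookup_add hom_add sum.distrib algebra_simps)
qed

lemma eval_poly_single: "eval_poly \<phi> x (Poly_Mapping.single a c) = \<phi> c * monom_eval x a"
  by (simp add: eval_poly_monom_eval)

lemma eval_poly_sum: "eval_poly \<phi> x (sum f A) = (\<Sum>i\<in>A. eval_poly \<phi> x (f i))"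
  by (induction A rule: infinite_finite_induct)
     (auto simp: eval_poly_add, auto simp: eval_poly_monom_eval)

lemma eval_poly_mult: "eval_poly \<phi> x (f * g) = eval_poly \<phi> x f * eval_poly \<phi> x g"
proof -
  have "f * g = (\<Sum>a\<in>Poly_Mapping.keys f. \<Sum>b\<in>Poly_Mapping.keys g.
      Poly_Mapping.single (a + b) (Poly_Mapping.lookup f a * Poly_Mapping.lookup g b))"
    by (subst poly_mapping_sum_single[of f], subst poly_mapping_sum_single[of g])
       (simp add: sum_distrib_left sum_distrib_right mult_single, rule sum.swap)
  also have "eval_poly \<phi> x \<dots> = (\<Sum>a\<in>Poly_Mapping.keys f. \<Sum>b\<in>Poly_Mapping.keys g.
      (\<phi> (Poly_Mapping.lookup f a) * monom_eval x a) *
      (\<phi> (Poly_Mapping.lookup g b) * monom_eval x b))"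
    by (simp only: eval_poly_sum eval_poly_single hom_mult monom_eval_add mult_ac)
  also have "\<dots> = eval_poly \<phi> x f * eval_poly \<phi> x g"
    by (simp only: eval_poly_monom_eval sum_product)
  finally show ?thesis .
qed

lemma eval_poly_Const: "eval_poly \<phi> x (Const c) = \<phi> c"
  by (simp add: Const_def eval_poly_single)

lemma eval_poly_Var: "eval_poly \<phi> x (Var i) = x i"
  by (simp add: Var_def eval_poly_single monom_eval_single)

lemma eval_poly_hom: "comm_ring_hom (eval_poly \<phi> x)"
proof unfold_locales
  show "eval_poly \<phi> x 1 = 1"
    using eval_poly_Const[of x 1] by (simp add: Const_def)
qed (simp_all add: eval_poly_add eval_poly_mult, simp add: eval_poly_monom_eval)

end

lemma hom_eval_poly:
  assumes "comm_ring_hom h"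
  shows "h (eval_poly \<phi> x f) = eval_poly (\<lambda>c. h (\<phi> c)) (\<lambda>i. h (x i)) f"
proof -
  interpret comm_ring_hom h by (rule assms)
  show ?thesis
    by (simp add: eval_poly_def hom_sum hom_mult hom_prod hom_power)
qed

lemma eval_poly_cong:
  assumes "\<And>i. i \<in> vars f \<Longrightarrow> x i = y i"
  shows "eval_poly \<phi> x f = eval_poly \<phi> y f"
  unfolding eval_poly_def
proof (intro sum.cong refl arg_cong2[where f = "(*)"] prod.cong arg_cong2[where f = "(^)"])
  fix a i assume "a \<in> Poly_Mapping.keys f" "i \<in> Poly_Mapping.keys a"
  then show "x i = y i" by (intro assms) (auto simp: vars_def)
qed

abbreviation ev :: "('v \<Rightarrow> complex) \<Rightarrow> 'v mpoly \<Rightarrow> complex" where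
  "ev \<equiv> eval_poly id"

interpretation ev: comm_ring_hom "ev x" for x
  by (rule eval_poly_hom[OF id_hom])

lemma ev_Const [simp]: "ev x (Const c) = c"
  and ev_Var [simp]: "ev x (Var i) = x i"
  by (simp_all add: eval_poly_Const[OF id_hom] eval_poly_Var[OF id_hom])

subsection \<open>Bounds on the weights of monomials\<close>

definition monom_weight :: "('v \<Rightarrow> real) \<Rightarrow> ('v \<Rightarrow>\<^sub>0 nat) \<Rightarrow> real" where
  "monom_weight w a = (\<Sum>i\<in>Poly_Mapping.keys a. w i * real (Poly_Mapping.lookup a i))"

lemma monom_weight_superset:
  assumes "finite A" "Poly_Mapping.keys a \<subseteq> A"
  shows "monom_weight w a = (\<Sum>i\<in>A. w i * real (Poly_Mapping.lookup a i))"
  unfolding monom_weight_def using assms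
  by (intro sum.mono_neutral_left) (auto simp: in_keys_iff)

lemma monom_weight_add: "monom_weight w (a + b) = monom_weight w a + monom_weight w b"
proof -
  let ?A = "Poly_Mapping.keys a \<union> Poly_Mapping.keys b"
  have "monom_weight w (a + b) = (\<Sum>i\<in>?A. w i * real (Poly_Mapping.lookup (a + b) i))"
    by (rule monom_weight_superset) (auto simp: keys_add_nat)
  also have "\<dots> = monom_weight w a + monom_weight w b"
    by (simp add: lookup_add distrib_left sum.distrib monom_weight_superset[of ?A])
  finally show ?thesis .
qed

lemma monom_weight_0 [simp]: "monom_weight w 0 = 0"
  by (simp add: monom_weight_def)

lemma monom_weight_single [simp]: "monom_weight w (Poly_Mapping.single i n) = w i * real n"
  by (simp add: monom_weight_def)

lemma monom_weight_cong:
  assumes "\<And>i. i \<in> Poly_Mapping.keys a \<Longrightarrow> w i = w' i"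
  shows "monom_weight w a = monom_weight w' a"
  unfolding monom_weight_def using assms by (intro sum.cong) auto

text \<open>An upper bound instead of the degree itself: it survives cancellation in sums, products
  and remainders and holds for \<open>0\<close>. Variables are tracked along with weights; for zero
  weights only the condition on variables is left.\<close>

definition weight_bounded :: "'v set \<Rightarrow> ('v \<Rightarrow> real) \<Rightarrow> real \<Rightarrow> 'v mpoly \<Rightarrow> bool" where
  "weight_bounded V w d f \<longleftrightarrow>
     (\<forall>a\<in>Poly_Mapping.keys f. Poly_Mapping.keys a \<subseteq> V \<and> monom_weight w a \<le> d)"

lemma weight_bounded_vars: "weight_bounded V w d f \<Longrightarrow> vars f \<subseteq> V"
  by (auto simp: weight_bounded_def vars_def)

lemma weight_bounded_zero_weight: "vars f \<subseteq> V \<Longrightarrow> weight_bounded V (\<lambda>_. 0) 0 f"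
  by (auto simp: weight_bounded_def vars_def monom_weight_def)

lemma weight_bounded_mono:
  "weight_bounded V w d f \<Longrightarrow> V \<subseteq> V' \<Longrightarrow> d \<le> d' \<Longrightarrow> weight_bounded V' w d' f"
  by (force simp: weight_bounded_def)

lemma weight_bounded_0 [simp]: "weight_bounded V w d 0"
  by (simp add: weight_bounded_def)

lemma weight_bounded_single:
  "Poly_Mapping.keys a \<subseteq> V \<Longrightarrow> monom_weight w a \<le> d \<Longrightarrow>
   weight_bounded V w d (Poly_Mapping.single a c)"
  by (auto simp: weight_bounded_def)

lemma weight_bounded_Const: "0 \<le> d \<Longrightarrow> weight_bounded V w d (Const c)"
  by (simp add: Const_def weight_bounded_single)

lemma weight_bounded_1: "0 \<le> d \<Longrightarrow> weight_bounded V w d 1"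
  using weight_bounded_Const[of d V w 1] by (simp add: Const_def)

lemma weight_bounded_Var: "i \<in> V \<Longrightarrow> w i \<le> d \<Longrightarrow> weight_bounded V w d (Var i)"
  by (simp add: Var_def weight_bounded_single)

lemma weight_bounded_add:
  "weight_bounded V w d f \<Longrightarrow> weight_bounded V w d g \<Longrightarrow> weight_bounded V w d (f + g)"
  unfolding weight_bounded_def using keys_add[of f g] by auto

lemma weight_bounded_diff:
  "weight_bounded V w d f \<Longrightarrow> weight_bounded V w d g \<Longrightarrow> weight_bounded V w d (f - g)"
  unfolding weight_bounded_def using keys_diff[of f g] by auto

lemma weight_bounded_sum:
  "(\<And>i. i \<in> A \<Longrightarrow> weight_bounded V w d (f i)) \<Longrightarrow> weight_bounded V w d (sum f A)"
  by (induction A rule: infinite_finite_induct) (auto intro: weight_bounded_add)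

lemma weight_bounded_mult:
  assumes "weight_bounded V w d f" "weight_bounded V w d' g"
  shows "weight_bounded V w (d + d') (f * g)"
  unfolding weight_bounded_def
proof
  fix c assume "c \<in> Poly_Mapping.keys (f * g)"
  then obtain a b where "c = a + b" "a \<in> Poly_Mapping.keys f" "b \<in> Poly_Mapping.keys g"
    using keys_mult[of f g] by blast
  then show "Poly_Mapping.keys c \<subseteq> V \<and> monom_weight w c \<le> d + d'"
    using assms by (auto simp: weight_bounded_def keys_add_nat monom_weight_add add_mono)
qed

lemma weight_bounded_prod:
  assumes "\<And>i. i \<in> A \<Longrightarrow> weight_bounded V w d (f i)"
  shows "weight_bounded V w (real (card A) * d) (prod f A)"
  using assms
proof (induction A rule: infinite_finite_induct)
  case (insert i A)
  then have "weight_bounded V w (d + real (card A) * d) (f i * prod f A)"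
    by (intro weight_bounded_mult) auto
  with insert show ?case by (simp add: algebra_simps)
qed (auto intro: weight_bounded_1)

lemma weight_bounded_power:
  "weight_bounded V w d f \<Longrightarrow> weight_bounded V w (real n * d) (f ^ n)"
  using weight_bounded_prod[of "{..<n}" V w d "\<lambda>_. f"] by simp

subsection \<open>Products of conjugates and their remainders\<close>

definition scale_var :: "'v \<Rightarrow> complex \<Rightarrow> 'v mpoly \<Rightarrow> 'v mpoly" where
  "scale_var k c = eval_poly Const (Var(k := Const c * Var k))"

interpretation scale_var: comm_ring_hom "scale_var k c" for k c
  unfolding scale_var_def by (rule eval_poly_hom[OF Const_hom])

lemma monom_eval_scale:
  "monom_eval (Var(k := Const c * Var k)) a =
     Poly_Mapping.single a (c ^ Poly_Mapping.lookup a k)"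
proof -
  interpret comm_ring_hom "Const :: complex \<Rightarrow> 'a mpoly" by (rule Const_hom)
  have "monom_eval (Var(k := Const c * Var k)) a =
      (\<Prod>i\<in>Poly_Mapping.keys a. (if i = k then Const c ^ Poly_Mapping.lookup a k else 1) *
         Var i ^ Poly_Mapping.lookup a i)"
    unfolding monom_eval_def by (intro prod.cong) (auto simp: power_mult_distrib)
  also have "\<dots> = Const c ^ Poly_Mapping.lookup a k * monom_eval Var a"
    by (simp add: prod.distrib monom_eval_def prod.delta in_keys_iff)
  also have "\<dots> = Poly_Mapping.single a (c ^ Poly_Mapping.lookup a k)"
    by (simp add: monom_eval_Var flip: hom_power) (simp add: Const_def mult_single)
  finally show ?thesis .
qed

text \<open>Scaling is diagonal in the monomials: it creates no new ones, and invariance under it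
  can be read off from each coefficient.\<close>

lemma lookup_scale_var:
  "Poly_Mapping.lookup (scale_var k c f) a =
     c ^ Poly_Mapping.lookup a k * Poly_Mapping.lookup f a"
proof -
  have "scale_var k c f = (\<Sum>b\<in>Poly_Mapping.keys f.
      Poly_Mapping.single b (Poly_Mapping.lookup f b * c ^ Poly_Mapping.lookup b k))"
    unfolding scale_var_def eval_poly_monom_eval monom_eval_scale by (simp add: Const_def mult_single)
  then show ?thesis
    by (auto simp: lookup_sum lookup_single when_def in_keys_iff)
qed

lemma ev_scale_var: "ev x (scale_var k c f) = ev (x(k := c * x k)) f"
proof -
  have "ev x (scale_var k c f) = eval_poly (\<lambda>c. ev x (Const c))
      (\<lambda>i. ev x ((Var(k := Const c * Var k)) i)) f"
    unfolding scale_var_def by (rule hom_eval_poly) unfold_locales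
  also have "(\<lambda>i. ev x ((Var(k := Const c * Var k)) i)) = x(k := c * x k)"
    by (auto simp: ev.hom_mult)
  also have "(\<lambda>c. ev x (Const c)) = id" by auto
  finally show ?thesis .
qed

lemma scale_var_scale_var: "scale_var k c (scale_var k d f) = scale_var k (c * d) f"
  by (rule poly_mapping_eqI) (simp add: lookup_scale_var power_mult_distrib)

lemma weight_bounded_scale_var:
  "weight_bounded V w d f \<Longrightarrow> weight_bounded V w d (scale_var k c f)"
  by (auto simp: weight_bounded_def in_keys_iff lookup_scale_var)

definition unity_root :: "nat \<Rightarrow> complex" where
  "unity_root n = exp (2 * pi * \<i> / n)"

lemma unity_root_power_eq_1_iff:
  assumes "n > 0"
  shows "unity_root n ^ j = 1 \<longleftrightarrow> n dvd j"
proof -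
  have "unity_root n ^ j = exp (2 * of_real pi * \<i> * of_nat j / of_nat n)"
    by (simp add: unity_root_def exp_of_nat_mult [symmetric] mult_ac)
  then show ?thesis
    using complex_root_unity_eq[of n j 0] assms by (simp add: cong_def dvd_eq_mod_eq_0)
qed

lemma unity_root_power_self: "n > 0 \<Longrightarrow> unity_root n ^ n = 1"
  using unity_root_power_eq_1_iff[of n n] by simp

lemma conj_product_scale:
  "conj_product e k f = (\<Prod>j\<in>{1..e k}. scale_var k (unity_root (e k) ^ j) f)"
  by (simp add: conj_product_def scale_var_def unity_root_def)

lemma weight_bounded_conj_product:
  assumes "weight_bounded V w d f"
  shows "weight_bounded V w (real (e k) * d) (conj_product e k f)"
  unfolding conj_product_scale
  using weight_bounded_prod[of "{1..e k}" V w d "\<lambda>j. scale_var k (unity_root (e k) ^ j) f"]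
    weight_bounded_scale_var[OF assms] by simp

text \<open>The product is invariant under \<open>\<Delta>\<^sub>k \<mapsto> \<gamma>\<^sub>k \<Delta>\<^sub>k\<close>, since this permutes the factors.\<close>

lemma conj_product_dvd:
  assumes "e k > 0" "a \<in> Poly_Mapping.keys (conj_product e k f)"
  shows "e k dvd Poly_Mapping.lookup a k"
proof -
  let ?u = "unity_root (e k)" and ?n = "e k"
  have u: "?u ^ ?n = 1" using unity_root_power_self assms(1) by simp
  have "scale_var k ?u (conj_product e k f) = (\<Prod>j\<in>{1..?n}. scale_var k (?u ^ Suc j) f)"
    by (simp add: conj_product_scale scale_var.hom_prod scale_var_scale_var)
  also have "\<dots> = (\<Prod>j\<in>{2..Suc ?n}. scale_var k (?u ^ j) f)"
    by (rule prod.reindex_bij_witness[of _ "\<lambda>j. j - 1" Suc]) auto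
  \<comment> \<open>Since \<open>?u ^ ?n = 1\<close>, the factor for \<open>Suc ?n\<close> is the
    missing factor for \<open>1\<close>.\<close>
  also have "{2..Suc ?n} = insert (Suc ?n) {2..?n}" using assms by auto
  also have "(\<Prod>j\<in>\<dots>. scale_var k (?u ^ j) f) =
      scale_var k (?u ^ 1) f * (\<Prod>j\<in>{2..?n}. scale_var k (?u ^ j) f)"
    using u by simp
  also have "\<dots> = (\<Prod>j\<in>insert 1 {2..?n}. scale_var k (?u ^ j) f)"
    by (subst prod.insert) auto
  also have "insert 1 {2..?n} = {1..?n}" using assms by auto
  finally have "scale_var k ?u (conj_product e k f) = conj_product e k f"
    by (simp add: conj_product_scale)
  from arg_cong[OF this, of "\<lambda>F. Poly_Mapping.lookup F a"]
  have "?u ^ Poly_Mapping.lookup a k = 1"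
    using assms(2) by (simp add: lookup_scale_var in_keys_iff)
  then show ?thesis using unity_root_power_eq_1_iff assms(1) by blast
qed

section \<open>Division by \<open>E_poly e g k\<close> with respect to variable
  \<open>k\<close>\<close>

lemma var_deg_less_iff:
  "var_deg k f < n \<longleftrightarrow> 0 < n \<and> (\<forall>a\<in>Poly_Mapping.keys f. Poly_Mapping.lookup a k < n)"
  by (simp add: var_deg_def)

text \<open>Let \<open>d\<close> be the largest exponent of variable \<open>k\<close> in
  \<open>h\<close>, reached at \<open>a\<close>. Multiplication by \<open>Var k ^ e k\<close> lifts
  it to \<open>d + e k\<close>, whereas \<open>h * g k\<close> stays at exponents up to
  \<open>d\<close>, so the lifted term cannot cancel.\<close>

lemma E_poly_multiple_exponent:
  assumes "e k > 0" "k \<notin> vars (g k)" "h \<noteq> 0"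
  obtains a where "a \<in> Poly_Mapping.keys (h * E_poly e g k)" "e k \<le> Poly_Mapping.lookup a k"
proof -
  let ?n = "e k"
  let ?t = "Poly_Mapping.single k ?n"
  define d where "d = Max ((\<lambda>a. Poly_Mapping.lookup a k) ` Poly_Mapping.keys h)"
  have ne: "Poly_Mapping.keys h \<noteq> {}" using assms by simp
  then have "d \<in> (\<lambda>a. Poly_Mapping.lookup a k) ` Poly_Mapping.keys h"
    unfolding d_def by (intro Max_in) auto
  then obtain a where a: "a \<in> Poly_Mapping.keys h" "Poly_Mapping.lookup a k = d"
    by auto
  have max: "Poly_Mapping.lookup b k \<le> d" if "b \<in> Poly_Mapping.keys h" for b
    using that by (simp add: d_def)
  have "h * Var k ^ ?n =
      (\<Sum>b\<in>Poly_Mapping.keys h. Poly_Mapping.single (b + ?t) (Poly_Mapping.lookup h b))"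
    by (subst poly_mapping_sum_single[of h]) (simp add: Var_power sum_distrib_right mult_single)
  then have 1: "Poly_Mapping.lookup (h * Var k ^ ?n) (a + ?t) = Poly_Mapping.lookup h a"
    using a by (simp add: lookup_sum lookup_single when_def)
  have 2: "a + ?t \<notin> Poly_Mapping.keys (h * g k)"
  proof
    assume "a + ?t \<in> Poly_Mapping.keys (h * g k)"
    then obtain b c where bc: "a + ?t = b + c"
      "b \<in> Poly_Mapping.keys h" "c \<in> Poly_Mapping.keys (g k)"
      using keys_mult[of h "g k"] by blast
    from bc(3) assms(2) have "Poly_Mapping.lookup c k = 0"
      by (auto simp: vars_def in_keys_iff)
    with arg_cong[OF bc(1), of "\<lambda>a. Poly_Mapping.lookup a k"] max[OF bc(2)] a assms(1)
    show False by (simp add: lookup_add)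
  qed
  have "Poly_Mapping.lookup (h * E_poly e g k) (a + ?t) \<noteq> 0"
    using 1 2 a by (simp add: E_poly_def right_diff_distrib lookup_minus in_keys_iff)
  then show ?thesis
    by (intro that[of "a + ?t"]) (auto simp: in_keys_iff lookup_add)
qed

text \<open>The difference of two remainders is a multiple of \<open>E_poly e g k\<close> whose
  exponents of variable \<open>k\<close> are all below \<open>e k\<close>, hence zero.\<close>

lemma is_var_rem_E_poly_unique:
  assumes "e k > 0" "k \<notin> vars (g k)"
    and "is_var_rem k f (E_poly e g k) r" "is_var_rem k f (E_poly e g k) r'"
  shows "r = r'"
proof (rule ccontr)
  let ?E = "E_poly e g k"
  assume ne: "r \<noteq> r'"
  from assms(3,4) obtain h h' where h: "f = h * ?E + r" "f = h' * ?E + r'"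
    and d: "var_deg k r < var_deg k ?E" "var_deg k r' < var_deg k ?E"
    unfolding is_var_rem_def by blast
  have 0: "Poly_Mapping.lookup c k = 0" if "c \<in> Poly_Mapping.keys (g k)" for c
    using that assms(2) by (auto simp: vars_def in_keys_iff)
  have "var_deg k ?E \<le> e k"
    unfolding var_deg_def E_poly_def Var_power
    using keys_diff[of "Poly_Mapping.single (Poly_Mapping.single k (e k)) 1" "g k"] 0 by auto
  then have small: "Poly_Mapping.lookup a k < e k" if "a \<in> Poly_Mapping.keys (r' - r)" for a
    using that keys_diff[of r' r] d order_less_le_trans
    unfolding var_deg_less_iff by blast
  have eq: "(h - h') * ?E = r' - r" using h by (simp add: algebra_simps)
  then have "h - h' \<noteq> 0" using ne by auto
  from E_poly_multiple_exponent[of e k g, OF assms(1,2) this] small eq show False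
    by (metis linorder_not_less)
qed

lemma diff_dvd_power_diff:
  fixes x y :: "'a::comm_ring_1"
  shows "x - y dvd x ^ n - y ^ n"
  by (simp add: power_diff_sumr2)

text \<open>Here division amounts to replacing each \<open>Var k ^ e k\<close> by
  \<open>g k\<close>, which removes variable \<open>k\<close> altogether and does not raise weights
  if \<open>g k\<close> weighs at most as much as \<open>Var k ^ e k\<close>. The bounds are
  quantified inside because one remainder serves all of them.\<close>

lemma exists_remainder_of_power_dvd:
  assumes "e k > 0" "vars (g k) \<subseteq> {..<k}"
    and dvd: "\<And>a. a \<in> Poly_Mapping.keys f \<Longrightarrow> e k dvd Poly_Mapping.lookup a k"
  shows "\<exists>h r. f = h * E_poly e g k + r \<and> k \<notin> vars r \<and>
    (\<forall>V w d. weight_bounded V w d f \<longrightarrow> weight_bounded {..<k} w (real (e k) * w k) (g k) \<longrightarrow>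
       weight_bounded (V - {k} \<union> {..<k}) w d r)"
proof -
  \<comment> \<open>A monomial \<open>a\<close> of \<open>f\<close> is \<open>b a\<close>, free of
    variable \<open>k\<close>, times \<open>l a\<close> copies of
    \<open>Var k ^ e k\<close>.\<close>
  define b :: "(nat \<Rightarrow>\<^sub>0 nat) \<Rightarrow> (nat \<Rightarrow>\<^sub>0 nat)"
    where "b = (\<lambda>a. a - Poly_Mapping.single k (Poly_Mapping.lookup a k))"
  define l :: "(nat \<Rightarrow>\<^sub>0 nat) \<Rightarrow> nat" where "l = (\<lambda>a. Poly_Mapping.lookup a k div e k)"
  define r where "r = (\<Sum>a\<in>Poly_Mapping.keys f.
    Poly_Mapping.single (b a) (Poly_Mapping.lookup f a) * g k ^ l a)"
  have split: "a = b a + Poly_Mapping.single k (Poly_Mapping.lookup a k)" for a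
    by (rule poly_mapping_eqI) (auto simp: b_def lookup_add lookup_minus lookup_single when_def)
  have keys_b: "Poly_Mapping.keys (b a) = Poly_Mapping.keys a - {k}" for a
    by (auto simp: b_def in_keys_iff lookup_minus lookup_single when_def split: if_splits)
  have el: "e k * l a = Poly_Mapping.lookup a k" if "a \<in> Poly_Mapping.keys f" for a
    using dvd[OF that] by (simp add: l_def)
  have diff: "Poly_Mapping.single a c - Poly_Mapping.single (b a) c * g k ^ l a =
      Poly_Mapping.single (b a) c * ((Var k ^ e k) ^ l a - g k ^ l a)"
    if "a \<in> Poly_Mapping.keys f" for a c
  proof -
    have "(Var k ^ e k) ^ l a = Var k ^ Poly_Mapping.lookup a k"
      by (metis el[OF that] power_mult)
    then have "Poly_Mapping.single (b a) c * (Var k ^ e k) ^ l a = Poly_Mapping.single a c"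
      by (simp add: Var_power mult_single flip: split)
    then show ?thesis by (simp add: right_diff_distrib)
  qed
  have "f - r = (\<Sum>a\<in>Poly_Mapping.keys f. Poly_Mapping.single a (Poly_Mapping.lookup f a) -
      Poly_Mapping.single (b a) (Poly_Mapping.lookup f a) * g k ^ l a)"
    by (simp add: r_def sum_subtractf flip: poly_mapping_sum_single)
  also have "E_poly e g k dvd \<dots>"
    by (rule dvd_sum) (simp add: diff E_poly_def diff_dvd_power_diff)
  finally obtain h where "f - r = E_poly e g k * h" by (auto simp: dvd_def)
  then have h: "f = h * E_poly e g k + r" by (simp add: algebra_simps)
  have wb: "weight_bounded (V - {k} \<union> {..<k}) w d r"
    if f: "weight_bounded V w d f" and gk: "weight_bounded {..<k} w (real (e k) * w k) (g k)" for V w d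
    unfolding r_def
  proof (rule weight_bounded_sum)
    fix a assume a: "a \<in> Poly_Mapping.keys f"
    let ?V = "V - {k} \<union> {..<k}"
    have 1: "weight_bounded ?V w (monom_weight w (b a))
        (Poly_Mapping.single (b a) (Poly_Mapping.lookup f a))"
      using f a keys_b[of a] by (intro weight_bounded_single) (auto simp: weight_bounded_def)
    have 2: "weight_bounded ?V w (real (l a) * (real (e k) * w k)) (g k ^ l a)"
      by (rule weight_bounded_power, rule weight_bounded_mono[OF gk]) auto
    have "monom_weight w a = monom_weight w (b a) + w k * real (Poly_Mapping.lookup a k)"
      by (subst split[of a]) (simp add: monom_weight_add)
    also have "\<dots> = monom_weight w (b a) + real (l a) * (real (e k) * w k)"
      by (simp add: mult_ac flip: el[OF a])
    finally have "monom_weight w (b a) + real (l a) * (real (e k) * w k) \<le> d"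
      using f a by (auto simp: weight_bounded_def)
    then show "weight_bounded ?V w d
        (Poly_Mapping.single (b a) (Poly_Mapping.lookup f a) * g k ^ l a)"
      using weight_bounded_mult[OF 1 2] weight_bounded_mono by blast
  qed
  \<comment> \<open>With all weights zero, \<open>wb\<close> merely confines the variables of
    \<open>r\<close> to the complement of \<open>k\<close>.\<close>
  have "k \<notin> vars r"
    using wb[OF weight_bounded_zero_weight[of f UNIV]] weight_bounded_zero_weight[OF assms(2)]
      weight_bounded_vars by fastforce
  with h wb show ?thesis by blast
qed

section \<open>One step of \<open>R_poly\<close>: the norm along variable \<open>k\<close>\<close>

definition conj_rem :: "(nat \<Rightarrow> nat) \<Rightarrow> (nat \<Rightarrow> nat mpoly) \<Rightarrow> nat \<Rightarrow> nat mpoly \<Rightarrow> nat mpoly" where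
  "conj_rem e g k f = var_rem k (conj_product e k f) (E_poly e g k)"

text \<open>By uniqueness, \<open>var_rem\<close> is the remainder obtained by substituting
  \<open>g k\<close>, and inherits its properties. The set \<open>{..<k}\<close> is added because
  \<open>g k\<close> brings in lower variables.\<close>

lemma conj_rem:
  assumes "e k > 0" "vars (g k) \<subseteq> {..<k}"
  shows "\<exists>h. conj_product e k f = h * E_poly e g k + conj_rem e g k f"
    and "k \<notin> vars (conj_rem e g k f)"
    and "weight_bounded V w d f \<Longrightarrow> weight_bounded {..<k} w (real (e k) * w k) (g k) \<Longrightarrow>
       weight_bounded (V - {k} \<union> {..<k}) w (real (e k) * d) (conj_rem e g k f)"
proof -
  let ?F = "conj_product e k f" and ?E = "E_poly e g k"
  have k: "k \<notin> vars (g k)" using assms by auto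
  obtain h r where r: "?F = h * ?E + r" "k \<notin> vars r"
    "\<And>V w d. weight_bounded V w d ?F \<Longrightarrow> weight_bounded {..<k} w (real (e k) * w k) (g k) \<Longrightarrow>
       weight_bounded (V - {k} \<union> {..<k}) w d r"
    using exists_remainder_of_power_dvd[of e k g ?F] conj_product_dvd[of e k] assms by blast
  \<comment> \<open>Together with \<open>var_deg k ?E \<ge> e k > 0\<close> this makes
    \<open>r\<close> small enough to be the remainder.\<close>
  have r0: "var_deg k r = 0"
    using r(2) by (auto simp: var_deg_def vars_def in_keys_iff intro!: Max_eqI)
  obtain a where a: "a \<in> Poly_Mapping.keys ?E" "e k \<le> Poly_Mapping.lookup a k"
    using E_poly_multiple_exponent[of e k g 1, OF assms(1) k] by auto
  have "\<not> var_deg k ?E < e k"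
    using a by (meson leD var_deg_less_iff)
  then have "is_var_rem k ?F ?E r"
    using r r0 assms(1) by (auto simp: is_var_rem_def)
  then have "conj_rem e g k f = r"
    unfolding conj_rem_def var_rem_def
    using is_var_rem_E_poly_unique[of e k g, OF assms(1) k] by (intro the_equality) auto
  with r show "\<exists>h. ?F = h * ?E + conj_rem e g k f" "k \<notin> vars (conj_rem e g k f)"
    "weight_bounded V w d f \<Longrightarrow> weight_bounded {..<k} w (real (e k) * w k) (g k) \<Longrightarrow>
       weight_bounded (V - {k} \<union> {..<k}) w (real (e k) * d) (conj_rem e g k f)"
    using r(3)[OF weight_bounded_conj_product[of V w d f e k]] by auto
qed

lemma R_poly_Suc: "R_poly e g (Suc k) f = R_poly e g k (conj_rem e g (Suc k) f)"
  by (simp add: conj_rem_def)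

text \<open>Move coordinate \<open>k\<close> to the root \<open>z\<close>: then
  \<open>E_poly e g k\<close> vanishes and the remainder equals the product of conjugates, while the
  remainder itself, free of variable \<open>k\<close>, keeps its value.\<close>

lemma ev_conj_rem:
  assumes "e k > 0" "vars (g k) \<subseteq> {..<k}" "z ^ e k = ev a (g k)"
  shows "ev a (conj_rem e g k f) = (\<Prod>j\<in>{1..e k}. ev (a(k := unity_root (e k) ^ j * z)) f)"
proof -
  let ?a = "a(k := z)"
  obtain h where h: "conj_product e k f = h * E_poly e g k + conj_rem e g k f"
    using conj_rem(1)[of e k g f, OF assms(1,2)] by blast
  have "ev ?a (g k) = ev a (g k)"
    using assms(2) by (intro eval_poly_cong) auto
  then have "ev ?a (E_poly e g k) = 0"
    using assms(3) by (simp add: E_poly_def ev.hom_minus ev.hom_power)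
  then have "ev ?a (conj_rem e g k f) = ev ?a (conj_product e k f)"
    by (simp add: h ev.hom_add ev.hom_mult)
  moreover have "ev ?a (conj_rem e g k f) = ev a (conj_rem e g k f)"
    using conj_rem(2)[of e k g f, OF assms(1,2)] by (intro eval_poly_cong) (metis fun_upd_apply)
  ultimately show ?thesis
    by (simp add: conj_product_scale ev.hom_prod ev_scale_var)
qed

subsection \<open>Zeros and weights of \<open>R(f)\<close>\<close>

text \<open>The coordinates beyond \<open>k\<close> are fixed by \<open>b\<close> just like
  \<open>t\<close>; those beyond \<open>m\<close> can therefore act as parameters holding the
  coordinates of a point of the target space.\<close>

definition fibre ::
  "(nat \<Rightarrow> nat) \<Rightarrow> (nat \<Rightarrow> nat mpoly) \<Rightarrow> nat \<Rightarrow> (nat \<Rightarrow> complex) \<Rightarrow> (nat \<Rightarrow> complex) set"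
where
  "fibre e g k b = {a. (\<forall>i. i \<notin> {1..k} \<longrightarrow> a i = b i) \<and> (\<forall>i\<in>{1..k}. a i ^ e i = ev a (g i))}"

lemma exists_complex_root:
  fixes c :: complex
  assumes "n > 0"
  obtains z where "z ^ n = c"
proof (cases "c = 0")
  case True
  with assms that[of 0] show ?thesis by simp
next
  case False
  with assms have "exp (Ln c / of_nat n) ^ n = c"
    by (simp flip: exp_of_nat_mult)
  then show ?thesis by (rule that)
qed

locale radical_equations =
  fixes e :: "nat \<Rightarrow> nat" and g :: "nat \<Rightarrow> nat mpoly" and m :: nat
  assumes exponent_pos: "\<And>i. i \<in> {1..m} \<Longrightarrow> e i > 0"
    and vars_g: "\<And>i. i \<in> {1..m} \<Longrightarrow> vars (g i) \<subseteq> {..<i}"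
begin

lemma fibre_Suc_iff:
  assumes "Suc k \<le> m"
  shows "a \<in> fibre e g (Suc k) b \<longleftrightarrow>
    a(Suc k := b (Suc k)) \<in> fibre e g k b \<and> a (Suc k) ^ e (Suc k) = ev a (g (Suc k))"
proof -
  have "ev (a(Suc k := b (Suc k))) (g i) = ev a (g i)" if "i \<in> {1..k}" for i
    using vars_g[of i] that assms by (intro eval_poly_cong) auto
  moreover have "{1..Suc k} = insert (Suc k) {1..k}" by auto
  ultimately show ?thesis
    unfolding fibre_def by auto
qed

lemma fibre_upd:
  assumes "Suc k \<le> m" "a \<in> fibre e g k b" "z ^ e (Suc k) = ev a (g (Suc k))"
  shows "a(Suc k := z) \<in> fibre e g (Suc k) b"
proof -
  have "ev (a(Suc k := z)) (g (Suc k)) = ev a (g (Suc k))"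
    using vars_g[of "Suc k"] assms(1) by (intro eval_poly_cong) auto
  moreover have "a (Suc k) = b (Suc k)" using assms(2) by (simp add: fibre_def)
  then have "a(Suc k := b (Suc k)) = a" by auto
  ultimately show ?thesis using assms by (simp add: fibre_Suc_iff)
qed

text \<open>The equations are triangular: each new coordinate is one of finitely many roots of a
  number fixed by the earlier coordinates.\<close>

lemma finite_fibre: "k \<le> m \<Longrightarrow> finite (fibre e g k b)"
proof (induction k)
  case 0
  have "fibre e g 0 b = {b}" by (auto simp: fibre_def)
  then show ?case by simp
next
  case (Suc k)
  let ?n = "e (Suc k)"
  have "finite {z :: complex. z ^ ?n = c}" for c
    using finite_nth_roots[of ?n c] exponent_pos[of "Suc k"] Suc.prems by simp
  then have "finite (\<Union>a\<in>fibre e g k b. (\<lambda>z. a(Suc k := z)) ` {z. z ^ ?n = ev a (g (Suc k))})"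
    using Suc by auto
  moreover have "fibre e g (Suc k) b \<subseteq> \<dots>"
  proof
    fix a assume a: "a \<in> fibre e g (Suc k) b"
    let ?a = "a(Suc k := b (Suc k))"
    have "ev ?a (g (Suc k)) = ev a (g (Suc k))"
      using vars_g[of "Suc k"] Suc.prems by (intro eval_poly_cong) auto
    then have "?a \<in> fibre e g k b" "a (Suc k) ^ ?n = ev ?a (g (Suc k))"
      using a Suc.prems by (auto simp: fibre_Suc_iff)
    moreover have "a = ?a(Suc k := a (Suc k))" by auto
    ultimately show "a \<in> (\<Union>a\<in>fibre e g k b. (\<lambda>z. a(Suc k := z)) ` {z. z ^ ?n = ev a (g (Suc k))})"
      by blast
  qed
  ultimately show ?case by (rule rev_finite_subset)
qed

lemma ev_conj_rem_Suc:
  assumes "Suc k \<le> m" "z ^ e (Suc k) = ev a (g (Suc k))"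
  shows "ev a (conj_rem e g (Suc k) f) =
    (\<Prod>j\<in>{1..e (Suc k)}. ev (a(Suc k := unity_root (e (Suc k)) ^ j * z)) f)"
  using assms exponent_pos[of "Suc k"] vars_g[of "Suc k"] by (intro ev_conj_rem) auto

text \<open>By induction, each norm step being a product of the values of \<open>f\<close> at points
  with rotated last coordinate: it vanishes iff a factor does, and rotation by a root of unity stays
  in the fibre.\<close>

lemma ev_R_poly_eq_0_iff:
  "k \<le> m \<Longrightarrow> ev b (R_poly e g k f) = 0 \<longleftrightarrow> (\<exists>a\<in>fibre e g k b. ev a f = 0)"
proof (induction k arbitrary: f)
  case 0
  have "fibre e g 0 b = {b}" by (auto simp: fibre_def)
  then show ?case by simp
next
  case (Suc k)
  let ?n = "e (Suc k)" and ?r = "conj_rem e g (Suc k) f"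
  have n: "?n > 0" using exponent_pos Suc.prems by simp
  have "(\<exists>a\<in>fibre e g k b. ev a ?r = 0) \<longleftrightarrow> (\<exists>a\<in>fibre e g (Suc k) b. ev a f = 0)"
  proof
    assume "\<exists>a\<in>fibre e g k b. ev a ?r = 0"
    then obtain a where a: "a \<in> fibre e g k b" "ev a ?r = 0" by blast
    obtain z where z: "z ^ ?n = ev a (g (Suc k))" using exists_complex_root[OF n] .
    obtain j where j: "ev (a(Suc k := unity_root ?n ^ j * z)) f = 0"
      using a(2) ev_conj_rem_Suc[OF Suc.prems z, of f] by auto
    have "(unity_root ?n ^ j * z) ^ ?n = (unity_root ?n ^ ?n) ^ j * z ^ ?n"
      by (simp add: power_mult_distrib mult.commute flip: power_mult)
    then have "(unity_root ?n ^ j * z) ^ ?n = ev a (g (Suc k))"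
      using z unity_root_power_self[OF n] by simp
    from fibre_upd[OF Suc.prems a(1) this] j
    show "\<exists>a\<in>fibre e g (Suc k) b. ev a f = 0" by blast
  next
    assume "\<exists>a\<in>fibre e g (Suc k) b. ev a f = 0"
    then obtain a where a: "a \<in> fibre e g (Suc k) b" "ev a f = 0" by blast
    let ?a = "a(Suc k := b (Suc k))"
    have "ev ?a (g (Suc k)) = ev a (g (Suc k))"
      using vars_g[of "Suc k"] Suc.prems by (intro eval_poly_cong) auto
    then have fa: "?a \<in> fibre e g k b" and z: "a (Suc k) ^ ?n = ev ?a (g (Suc k))"
      using a(1) Suc.prems by (auto simp: fibre_Suc_iff)
    have "ev ?a ?r = (\<Prod>j\<in>{1..?n}. ev (a(Suc k := unity_root ?n ^ j * a (Suc k))) f)"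
      using ev_conj_rem_Suc[OF Suc.prems z, of f] by simp
    \<comment> \<open>The index \<open>?n\<close> gives rotation by \<open>1\<close>, hence the
      factor at \<open>a\<close> itself.\<close>
    also have "\<dots> = 0"
      using a(2) n unity_root_power_self[OF n] by (intro prod_zero bexI[of _ ?n]) auto
    finally show "\<exists>a\<in>fibre e g k b. ev a ?r = 0" using fa by blast
  qed
  then show ?case
    using Suc.IH[of ?r] Suc.prems by (simp only: R_poly_Suc)
qed

text \<open>Allows a parameter variable to be specialized before forming \<open>R_poly\<close>
  instead of after it.\<close>

lemma ev_R_poly_cong:
  "k \<le> m \<Longrightarrow> (\<And>a. (\<And>i. i \<notin> {1..k} \<Longrightarrow> a i = b i) \<Longrightarrow> ev a f = ev a f') \<Longrightarrow>
   ev b (R_poly e g k f) = ev b (R_poly e g k f')"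
proof (induction k arbitrary: f f')
  case 0
  then show ?case by simp
next
  case (Suc k)
  have "ev b (R_poly e g k (conj_rem e g (Suc k) f)) =
      ev b (R_poly e g k (conj_rem e g (Suc k) f'))"
  proof (rule Suc.IH)
    fix a assume a: "\<And>i. i \<notin> {1..k} \<Longrightarrow> a i = b i"
    obtain z where z: "z ^ e (Suc k) = ev a (g (Suc k))"
      using exists_complex_root exponent_pos[of "Suc k"] Suc.prems(1) by auto
    have "ev (a(Suc k := c)) f = ev (a(Suc k := c)) f'" for c
      by (rule Suc.prems(2)) (use a in auto)
    then show "ev a (conj_rem e g (Suc k) f) = ev a (conj_rem e g (Suc k) f')"
      by (simp only: ev_conj_rem_Suc[OF Suc.prems(1) z])
  qed (use Suc.prems in simp)
  then show ?case by (simp only: R_poly_Suc)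
qed

text \<open>Each step multiplies the bound by \<open>e k\<close> and drops variable
  \<open>k\<close>. The weights \<open>w\<close> are arbitrary subject to the condition on the
  \<open>g i\<close>, so that parameter variables in \<open>V\<close> can be given weights
  too.\<close>

lemma weight_bounded_R_poly:
  assumes "\<And>i. i \<in> {1..m} \<Longrightarrow> weight_bounded {..<i} w (real (e i) * w i) (g i)"
  shows "k \<le> m \<Longrightarrow> weight_bounded V w d f \<Longrightarrow>
    weight_bounded (V - {1..k} \<union> {0}) w (d * real (\<Prod>i\<in>{1..k}. e i)) (R_poly e g k f)"
proof (induction k arbitrary: V d f)
  case 0
  then show ?case by (auto intro: weight_bounded_mono)
next
  case (Suc k)
  let ?V = "V - {Suc k} \<union> {..<Suc k}"
  have "weight_bounded ?V w (real (e (Suc k)) * d) (conj_rem e g (Suc k) f)"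
    using Suc.prems assms[of "Suc k"] exponent_pos[of "Suc k"] vars_g[of "Suc k"]
    by (intro conj_rem(3)) auto
  from Suc.IH[OF _ this] Suc.prems(1)
  have "weight_bounded (?V - {1..k} \<union> {0}) w
      (real (e (Suc k)) * d * real (\<Prod>i\<in>{1..k}. e i)) (R_poly e g (Suc k) f)"
    by (simp only: R_poly_Suc)
  then show ?case
    by (rule weight_bounded_mono) (auto simp: mult_ac)
qed

end

subsection \<open>Weighted degrees\<close>

lemma weighted_deg_eq:
  assumes "f \<noteq> 0"
  obtains a where "a \<in> Poly_Mapping.keys f" "weighted_deg w f = ereal (monom_weight w a)"
    "\<And>b. b \<in> Poly_Mapping.keys f \<Longrightarrow> monom_weight w b \<le> monom_weight w a"
proof -
  let ?S = "monom_weight w ` Poly_Mapping.keys f"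
  have "?S \<noteq> {}" using assms by simp
  then have "Max ?S \<in> ?S" by (intro Max_in) auto
  then obtain a where a: "a \<in> Poly_Mapping.keys f" "monom_weight w a = Max ?S" by auto
  have le: "monom_weight w b \<le> monom_weight w a" if "b \<in> Poly_Mapping.keys f" for b
    using that a by simp
  have "weighted_deg w f = (SUP b\<in>Poly_Mapping.keys f. ereal (monom_weight w b))"
    by (simp add: weighted_deg_def monom_weight_def)
  also have "\<dots> = ereal (monom_weight w a)"
    using a le by (intro antisym SUP_least SUP_upper2[of a]) auto
  finally show ?thesis using that a le by blast
qed

lemma weighted_deg_0: "weighted_deg w 0 = -\<infinity>"
  by (simp add: weighted_deg_def bot_ereal_def)

lemma weighted_deg_cong:
  assumes "\<And>i. i \<in> vars f \<Longrightarrow> w i = w' i"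
  shows "weighted_deg w f = weighted_deg w' f"
proof -
  have "monom_weight w a = monom_weight w' a" if "a \<in> Poly_Mapping.keys f" for a
    using that assms by (intro monom_weight_cong) (auto simp: vars_def)
  then show ?thesis
    by (simp add: weighted_deg_def flip: monom_weight_def)
qed

lemma weights_stable: "i \<le> k \<Longrightarrow> k \<le> m \<Longrightarrow> weights e g m i = weights e g k i"
  by (induction m) (auto simp: le_Suc_eq)

lemma weights_0: "weights e g m 0 = 1"
  by (induction m) auto

lemma weights_Suc:
  assumes "Suc k \<le> m" "vars (g (Suc k)) \<subseteq> {..k}"
  shows "weights e g m (Suc k) =
    real_of_ereal (weighted_deg (weights e g m) (g (Suc k))) / real (e (Suc k))"
proof -
  have "weights e g m (Suc k) = weights e g (Suc k) (Suc k)"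
    using assms by (intro weights_stable) auto
  moreover have "weighted_deg (weights e g k) (g (Suc k)) = weighted_deg (weights e g m) (g (Suc k))"
    using assms weights_stable[of _ k m e g] by (intro weighted_deg_cong) auto
  ultimately show ?thesis by simp
qed

locale nonzero_radical_equations = radical_equations +
  assumes g_nonzero: "\<And>i. i \<in> {1..m} \<Longrightarrow> g i \<noteq> 0"
begin

lemma weights_eq:
  assumes "i \<in> {1..m}"
  shows "real (e i) * weights e g m i = real_of_ereal (weighted_deg (weights e g m) (g i))"
proof -
  obtain k where k: "i = Suc k" using assms by (cases i) auto
  show ?thesis
    unfolding k using weights_Suc[of k m g e] assms exponent_pos[OF assms] vars_g[OF assms]
    by (simp add: k lessThan_Suc_atMost)
qed

text \<open>The weights are made for this: \<open>Var i ^ e i\<close> and \<open>g i\<close> get the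
  same weighted degree.\<close>

lemma weight_bounded_g:
  assumes "i \<in> {1..m}"
  shows "weight_bounded {..<i} (weights e g m) (real (e i) * weights e g m i) (g i)"
proof -
  obtain a where "weighted_deg (weights e g m) (g i) = ereal (monom_weight (weights e g m) a)"
    "\<And>b. b \<in> Poly_Mapping.keys (g i) \<Longrightarrow>
       monom_weight (weights e g m) b \<le> monom_weight (weights e g m) a"
    using weighted_deg_eq[OF g_nonzero[OF assms]] by metis
  then show ?thesis
    using vars_g[OF assms] by (auto simp: weights_eq[OF assms] weight_bounded_def vars_def)
qed

end

subsection \<open>Elimination of \<open>t\<close>\<close>

text \<open>Variable \<open>0\<close> becomes the polynomial variable and the others become
  coefficients: polynomials in the target coordinates for \<open>\<phi> = Const\<close>, numbers for
  \<open>\<phi> = id\<close>.\<close>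

definition as_poly :: "(complex \<Rightarrow> 'b::comm_ring_1) \<Rightarrow> (nat \<Rightarrow> 'b) \<Rightarrow> nat mpoly \<Rightarrow> 'b poly" where
  "as_poly \<phi> y = eval_poly (\<lambda>c. [:\<phi> c:]) (\<lambda>i. if i = 0 then [:0, 1:] else [:y i:])"

lemma poly_as_poly: "poly (as_poly id y f) t = ev (y(0 := t)) f"
proof -
  have "comm_ring_hom (\<lambda>P :: complex poly. poly P t)"
    by unfold_locales auto
  from hom_eval_poly[OF this] have "poly (as_poly id y f) t =
      eval_poly (\<lambda>c. poly [:id c:] t) (\<lambda>i. poly (if i = 0 then [:0, 1:] else [:y i:]) t) f"
    unfolding as_poly_def .
  also have "(\<lambda>i. poly (if i = 0 then [:0, 1:] else [:y i:]) t) = y(0 := t)" by auto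
  also have "(\<lambda>c. poly [:id c:] t) = id" by auto
  finally show ?thesis .
qed

lemma map_poly_as_poly:
  "map_poly (ev z) (as_poly Const y f) = as_poly id (\<lambda>i. ev z (y i)) f"
proof -
  interpret h: map_poly_comm_ring_hom "ev z" ..
  have "comm_ring_hom (map_poly (ev z))" by unfold_locales
  from hom_eval_poly[OF this] have "map_poly (ev z) (as_poly Const y f) =
      eval_poly (\<lambda>c. map_poly (ev z) [:Const c:])
        (\<lambda>i. map_poly (ev z) (if i = 0 then [:0, 1:] else [:y i:])) f"
    unfolding as_poly_def .
  also have "(\<lambda>c. map_poly (ev z) [:Const c:]) = (\<lambda>c. [:id c:])"
    by (intro ext poly_eqI) (simp add: coeff_map_poly coeff_pCons split: nat.split)
  also have "(\<lambda>i. map_poly (ev z) (if i = 0 then [:0, 1:] else [:y i:])) =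
      (\<lambda>i. if i = 0 then [:0, 1:] else [:ev z (y i):])"
    by (intro ext poly_eqI) (auto simp: coeff_map_poly coeff_pCons split: nat.split)
  finally show ?thesis unfolding as_poly_def .
qed

text \<open>The entries \<open>y i\<close> are constants, so only the exponent of variable
  \<open>0\<close> contributes to the degree, and only the pure power with exponent \<open>N\<close>
  reaches degree \<open>N\<close>.\<close>

lemma coeff_as_poly:
  assumes "comm_ring_hom \<phi>"
    and "\<And>a. a \<in> Poly_Mapping.keys f \<Longrightarrow>
      Poly_Mapping.lookup a 0 < N \<or> a = Poly_Mapping.single 0 N"
  shows "coeff (as_poly \<phi> y f) N = \<phi> (Poly_Mapping.lookup f (Poly_Mapping.single 0 N))"
    and "degree (as_poly \<phi> y f) \<le> N"
proof -
  interpret comm_ring_hom \<phi> by (rule assms)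
  define X where "X = (\<lambda>i::nat. if i = 0 then [:0, 1:] else [:y i:])"
  let ?l = Poly_Mapping.lookup
  have deg: "degree (monom_eval X a) \<le> ?l a 0" for a
  proof -
    have "degree (monom_eval X a) \<le> (\<Sum>i\<in>Poly_Mapping.keys a. degree (X i ^ ?l a i))"
      unfolding monom_eval_def by (rule degree_prod_sum_le[unfolded o_def]) simp
    also have "\<dots> \<le> (\<Sum>i\<in>Poly_Mapping.keys a. if i = 0 then ?l a 0 else 0)"
    proof (rule sum_mono)
      fix i
      have "degree (X i ^ ?l a i) \<le> degree (X i) * ?l a i" by (rule degree_power_le)
      also have "\<dots> \<le> (if i = 0 then ?l a 0 else 0)" by (auto simp: X_def)
      finally show "degree (X i ^ ?l a i) \<le> (if i = 0 then ?l a 0 else 0)" .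
    qed
    also have "\<dots> \<le> ?l a 0" by (simp add: sum.delta)
    finally show ?thesis .
  qed
  have eq: "as_poly \<phi> y f = (\<Sum>a\<in>Poly_Mapping.keys f. smult (\<phi> (?l f a)) (monom_eval X a))"
    by (simp add: as_poly_def eval_poly_monom_eval X_def)
  have "?l a 0 \<le> N" if "a \<in> Poly_Mapping.keys f" for a
    using assms(2)[OF that] by auto
  then show "degree (as_poly \<phi> y f) \<le> N"
    unfolding eq using deg
    by (intro degree_sum_le order.trans[OF degree_smult_le]) (auto intro: order.trans)
  have "coeff (smult (\<phi> (?l f a)) (monom_eval X a)) N =
      (if a = Poly_Mapping.single 0 N then \<phi> (?l f a) else 0)" if "a \<in> Poly_Mapping.keys f" for a
  proof (cases "a = Poly_Mapping.single 0 N")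
    case True
    have "monom_eval X (Poly_Mapping.single 0 N) = monom 1 N"
      by (simp add: monom_eval_single X_def monom_altdef)
    with True show ?thesis by simp
  next
    case False
    then have "degree (monom_eval X a) < N"
      using assms(2)[OF that] deg[of a] by linarith
    with False show ?thesis by (simp add: coeff_eq_0)
  qed
  then have "coeff (as_poly \<phi> y f) N =
      (\<Sum>a\<in>Poly_Mapping.keys f. if a = Poly_Mapping.single 0 N then \<phi> (?l f a) else 0)"
    unfolding eq coeff_sum by (intro sum.cong) auto
  then show "coeff (as_poly \<phi> y f) N = \<phi> (?l f (Poly_Mapping.single 0 N))"
    by (auto simp: sum.delta in_keys_iff)
qed

section \<open>Resultants and specialization\<close>

text \<open>A vanishing resultant means a nonconstant gcd, and over the complex numbers a nonzero
  polynomial is nonconstant iff it has a root.\<close>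

lemma resultant_eq_0_iff_common_root:
  fixes P Q :: "complex poly"
  assumes "P \<noteq> 0"
  shows "resultant P Q = 0 \<longleftrightarrow> (\<exists>t. poly P t = 0 \<and> poly Q t = 0)"
proof -
  have nz: "gcd P Q \<noteq> 0" using assms by simp
  have "degree (gcd P Q) \<noteq> 0 \<longleftrightarrow> (\<exists>t. poly (gcd P Q) t = 0)"
  proof
    assume "degree (gcd P Q) \<noteq> 0"
    then show "\<exists>t. poly (gcd P Q) t = 0"
      by (intro fundamental_theorem_of_algebra) (simp add: constant_degree)
  next
    assume "\<exists>t. poly (gcd P Q) t = 0"
    then show "degree (gcd P Q) \<noteq> 0"
      using nz by (auto elim!: degree_eq_zeroE)
  qed
  then show ?thesis by (simp add: resultant_0_gcd poly_eq_0_iff_dvd)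
qed

text \<open>
  Adding a multiple \<open>t\<^sup>K P\<close> to \<open>Q\<close> does not change the common roots with \<open>P\<close>, but
  makes the leading coefficient constant, so that the resultant commutes with specialization.
\<close>

lemma exists_eliminant:
  fixes P Q :: "'v mpoly poly"
  assumes "lead_coeff P = Const c" "c \<noteq> 0"
  shows "\<exists>H. \<forall>z. ev z H = 0 \<longleftrightarrow>
    (\<exists>t. poly (map_poly (ev z) P) t = 0 \<and> poly (map_poly (ev z) Q) t = 0)"
proof (intro exI allI)
  fix z :: "'v \<Rightarrow> complex"
  \<comment> \<open>So \<open>K + degree P\<close> exceeds the degree of \<open>Q\<close>, and
    \<open>T\<close> inherits the leading coefficient of \<open>P\<close>.\<close>
  define K where "K = Suc (degree Q)"
  define T where "T = Q + monom 1 K * P"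
  interpret h: map_poly_comm_ring_hom "ev z" ..
  have coeff: "coeff (monom 1 K * P) n = (if n < K then 0 else coeff P (n - K))" for n
    by (simp add: coeff_monom_mult)
  have cT: "coeff T (K + degree P) = Const c"
    using assms by (simp add: T_def coeff[unfolded K_def] coeff_eq_0 K_def)
  have "degree T \<le> K + degree P"
    by (rule degree_le) (auto simp: T_def coeff[unfolded K_def] coeff_eq_0 K_def)
  moreover have "K + degree P \<le> degree T"
    using cT assms by (intro le_degree) simp
  ultimately have dT: "degree T = K + degree P" by simp
  have degree_map: "degree (map_poly (ev z) A) = degree A" if "lead_coeff A = Const c" for A
    using that assms by (intro antisym degree_map_poly_le le_degree) (simp add: coeff_map_poly)
  have "resultant (map_poly (ev z) P) (map_poly (ev z) T) = ev z (resultant P T)"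
    by (intro ev.resultant_map_poly degree_map) (simp_all add: assms dT cT)
  moreover have "map_poly (ev z) P \<noteq> 0"
  proof
    assume "map_poly (ev z) P = 0"
    from arg_cong[OF this, of "\<lambda>A. coeff A (degree P)"] assms show False
      by (simp add: coeff_map_poly)
  qed
  moreover have "map_poly (ev z) T = map_poly (ev z) Q + map_poly (ev z) (monom 1 K) * map_poly (ev z) P"
    by (simp add: T_def h.hom_add h.hom_mult)
  \<comment> \<open>The witness must not depend on \<open>z\<close>; \<open>T\<close> and
    \<open>K\<close>, defined after fixing \<open>z\<close>, are therefore written out.\<close>
  ultimately show "ev z (resultant P (Q + monom 1 (Suc (degree Q)) * P)) = 0 \<longleftrightarrow>
    (\<exists>t. poly (map_poly (ev z) P) t = 0 \<and> poly (map_poly (ev z) Q) t = 0)"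
    using resultant_eq_0_iff_common_root[of "map_poly (ev z) P" "map_poly (ev z) T"]
    by (auto simp: T_def K_def)
qed

section \<open>The leading term in \<open>t\<close>\<close>

context nonzero_radical_equations
begin

text \<open>The second conclusion also excludes products of the \<open>N\<close>-th power of
  \<open>t\<close> with \<open>Var v\<close>, so that the leading coefficient in \<open>t\<close> is
  a constant.\<close>

lemma R_poly_top_monomial:
  assumes p: "vars p \<subseteq> {..m}" and q: "vars q \<subseteq> {..m}" "q \<noteq> 0"
    and "\<not> guilty m e g p" "deg m e g q < deg m e g p" and v: "m < v"
  obtains N where "Poly_Mapping.lookup (R_poly e g m (p - Var v * q)) (Poly_Mapping.single 0 N) \<noteq> 0"
    "\<And>a. a \<in> Poly_Mapping.keys (R_poly e g m (p - Var v * q)) \<Longrightarrow>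
       Poly_Mapping.lookup a 0 < N \<or> a = Poly_Mapping.single 0 N"
proof -
  let ?l = Poly_Mapping.lookup
  let ?W = "weights e g m" and ?D = "real (\<Prod>i\<in>{1..m}. e i)"
  define f where "f = p - Var v * q"
  have "p \<noteq> 0" using assms(5) by (auto simp: deg_def weighted_deg_0)
  then obtain a where a: "deg m e g p = ereal (monom_weight ?W a)"
    "\<And>b. b \<in> Poly_Mapping.keys p \<Longrightarrow> monom_weight ?W b \<le> monom_weight ?W a"
    unfolding deg_def using weighted_deg_eq by metis
  obtain b where b: "deg m e g q = ereal (monom_weight ?W b)"
    "\<And>c. c \<in> Poly_Mapping.keys q \<Longrightarrow> monom_weight ?W c \<le> monom_weight ?W b"
    unfolding deg_def using weighted_deg_eq[OF q(2)] by metis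
  define wp wq where "wp = monom_weight ?W a" and "wq = monom_weight ?W b"
  have less: "wq < wp" using assms(5) a b by (simp add: wp_def wq_def)
  \<comment> \<open>This weight bounds \<open>Var v * q\<close> by the degree \<open>wp\<close> of
    \<open>p\<close>, and it is positive.\<close>
  define W where "W = ?W(v := wp - wq)"
  have W: "monom_weight W c = monom_weight ?W c" if "Poly_Mapping.keys c \<subseteq> {..m}" for c
    using that v by (intro monom_weight_cong) (auto simp: W_def)
  have wb_iff: "weight_bounded V W d h \<longleftrightarrow> weight_bounded V ?W d h" if "V \<subseteq> {..m}" for V d h
    using that W unfolding weight_bounded_def by (metis subset_trans)
  have wp: "weight_bounded {..m} ?W wp p" and wq: "weight_bounded {..m} ?W wq q"
    using a b p q by (auto simp: weight_bounded_def vars_def wp_def wq_def)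
  let ?V = "insert v {..m}"
  have "weight_bounded ?V W (wp - wq + wq) (Var v * q)"
    using wq wb_iff[of "{..m}" wq q]
    by (intro weight_bounded_mult weight_bounded_Var)
       (auto simp: W_def intro: weight_bounded_mono)
  moreover have "weight_bounded ?V W wp p"
    using wp wb_iff[of "{..m}" wp p] by (auto intro: weight_bounded_mono)
  ultimately have f: "weight_bounded ?V W wp f"
    unfolding f_def by (intro weight_bounded_diff) auto
  have gW: "weight_bounded {..<i} W (real (e i) * W i) (g i)" if "i \<in> {1..m}" for i
  proof -
    have "{..<i} \<subseteq> {..m}" "W i = ?W i" using that v by (auto simp: W_def)
    then show ?thesis using weight_bounded_g[OF that] wb_iff by simp
  qed
  have Rf: "weight_bounded {0, v} W (wp * ?D) (R_poly e g m f)"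
    using weight_bounded_R_poly[OF gW order.refl f] by (rule weight_bounded_mono) auto
  have Rp: "weight_bounded {0} ?W (wp * ?D) (R_poly e g m p)"
    using weight_bounded_R_poly[OF weight_bounded_g order.refl wp] by (rule weight_bounded_mono) auto
  have top: "ereal (wp * ?D) \<le> weighted_deg ?W (R_poly e g m p)"
    using assms(4) a(1) by (simp add: guilty_def deg_def wp_def)
  then have "R_poly e g m p \<noteq> 0" by (auto simp: weighted_deg_0)
  then obtain c where c: "c \<in> Poly_Mapping.keys (R_poly e g m p)" "wp * ?D \<le> monom_weight ?W c"
    using weighted_deg_eq[of "R_poly e g m p" ?W] top by (metis ereal_less_eq(3))
  have single: "d = Poly_Mapping.single 0 (?l d 0)" if "Poly_Mapping.keys d \<subseteq> {0}"
    for d :: "nat \<Rightarrow>\<^sub>0 nat"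
    using that by (intro poly_mapping_eqI) (auto simp: lookup_single when_def in_keys_iff subset_iff)
  \<comment> \<open>\<open>R_poly e g m p\<close> involves only \<open>t\<close>, so its monomial
    \<open>c\<close>, which has top weight as \<open>p\<close> is not guilty, is a power of
    \<open>t\<close>; as \<open>t\<close> has weight 1, \<open>N\<close> is at least
    \<open>wp * ?D\<close>.\<close>
  define N where "N = ?l c 0"
  have cN: "c = Poly_Mapping.single 0 N"
    unfolding N_def using Rp c(1) by (intro single) (auto simp: weight_bounded_def)
  have N: "wp * ?D \<le> real N"
    using c(2) by (simp add: cN weights_0)
  have keys_f: "?l d 0 < N \<or> d = Poly_Mapping.single 0 N"
    if d: "d \<in> Poly_Mapping.keys (R_poly e g m f)" for d
  proof -
    have kd: "Poly_Mapping.keys d \<subseteq> {0, v}" and "monom_weight W d \<le> wp * ?D"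
      using Rf d by (auto simp: weight_bounded_def)
    moreover have "monom_weight W d = real (?l d 0) + (wp - wq) * real (?l d v)"
      using monom_weight_superset[OF _ kd, of W] v by (simp add: W_def weights_0)
    ultimately have le: "real (?l d 0) + (wp - wq) * real (?l d v) \<le> real N"
      using N by simp
    show ?thesis
    proof (cases "?l d v = 0")
      case True
      then have "d = Poly_Mapping.single 0 (?l d 0)"
        using kd in_keys_iff[of v d] by (intro single) auto
      then obtain n where "d = Poly_Mapping.single 0 n" by blast
      with le True show ?thesis by (cases n N rule: linorder_cases) auto
    \<comment> \<open>A monomial involving \<open>Var v\<close> spends positive weight on it,
      leaving less than \<open>N\<close> for \<open>t\<close>.\<close>
    next
      case False
      then have "(wp - wq) * real (?l d v) > 0" using less by simp
      with le show ?thesis by simp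
    qed
  qed
  have keys_p: "?l d 0 < N \<or> d = Poly_Mapping.single 0 N"
    if d: "d \<in> Poly_Mapping.keys (R_poly e g m p)" for d
  proof -
    have "d = Poly_Mapping.single 0 (?l d 0)" and w: "monom_weight ?W d \<le> real N"
      using Rp d N by (auto intro!: single simp: weight_bounded_def)
    then obtain n where n: "d = Poly_Mapping.single 0 n" by blast
    with w have "n \<le> N" by (simp add: weights_0)
    with n show ?thesis by (cases n N rule: linorder_cases) auto
  qed
  \<comment> \<open>Setting \<open>Var v\<close> to zero turns \<open>f\<close> into
    \<open>p\<close>. The coefficient at the pure power of \<open>t\<close> is unaffected, so it can
    be taken from \<open>p\<close>.\<close>
  have "as_poly id (\<lambda>_. 0) (R_poly e g m f) = as_poly id (\<lambda>_. 0) (R_poly e g m p)"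
  proof (rule poly_ext)
    fix t
    have "ev ((\<lambda>_. 0)(0 := t)) (R_poly e g m f) = ev ((\<lambda>_. 0)(0 := t)) (R_poly e g m p)"
    proof (rule ev_R_poly_cong)
      fix a assume "\<And>i. i \<notin> {1..m} \<Longrightarrow> a i = ((\<lambda>_. 0)(0 := t)) i"
      from this[of v] v have "a v = 0" by simp
      then show "ev a f = ev a p" by (simp add: f_def ev.hom_minus ev.hom_mult)
    qed simp
    then show "poly (as_poly id (\<lambda>_. 0) (R_poly e g m f)) t =
        poly (as_poly id (\<lambda>_. 0) (R_poly e g m p)) t"
      by (simp add: poly_as_poly)
  qed
  then have "?l (R_poly e g m f) (Poly_Mapping.single 0 N) =
      ?l (R_poly e g m p) (Poly_Mapping.single 0 N)"
    using coeff_as_poly(1)[where f = "R_poly e g m f" and y = "\<lambda>_. 0", OF id_hom keys_f]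
      coeff_as_poly(1)[where f = "R_poly e g m p" and y = "\<lambda>_. 0", OF id_hom keys_p]
    by simp
  then have "?l (R_poly e g m f) (Poly_Mapping.single 0 N) \<noteq> 0"
    using c(1) by (simp add: cN in_keys_iff)
  then show ?thesis using that keys_f by (simp add: f_def)
qed

end

section \<open>From eliminants to the closed image\<close>

text \<open>For fixed \<open>a\<close> the sum is a polynomial in \<open>s\<close> with coefficients
  \<open>v a j\<close>, as the exponents are distinct. Finitely many nonzero polynomials have too
  few roots to cover all \<open>s\<close>, so one of them is zero.\<close>

lemma exists_zero_of_vanishing_combinations:
  fixes v :: "'b \<Rightarrow> 'n::finite \<Rightarrow> complex"
  assumes "finite A" "inj idx" and "\<And>s. \<exists>a\<in>A. (\<Sum>j\<in>UNIV. s ^ idx j * v a j) = 0"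
  shows "\<exists>a\<in>A. \<forall>j. v a j = 0"
proof -
  define P where "P = (\<lambda>a. \<Sum>j\<in>UNIV. monom (v a j) (idx j))"
  have "poly (P a) s = (\<Sum>j\<in>UNIV. s ^ idx j * v a j)" for a s
    by (simp add: P_def poly_sum poly_monom mult.commute)
  then have "(\<Union>a\<in>A. {s. poly (P a) s = 0}) = UNIV"
    using assms(3) by auto
  then have "\<not> finite (\<Union>a\<in>A. {s. poly (P a) s = 0})"
    by (simp add: infinite_UNIV_char_0)
  then obtain a where a: "a \<in> A" "P a = 0"
    using assms(1) poly_roots_finite by blast
  have "coeff (P a) (idx j) = v a j" for j
    using assms(2) by (simp add: P_def coeff_sum inj_eq)
  with a show ?thesis by (metis coeff_0)
qed

theorem theorem3p8:
  fixes \<kappa> :: "complex poly fract \<Rightarrow> 'a::field"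
    and m :: nat
    and F :: "nat \<Rightarrow> 'a set"
    and \<delta> :: "nat \<Rightarrow> 'a"
    and e :: "nat \<Rightarrow> nat"
    and g :: "nat \<Rightarrow> nat mpoly"
    and p q :: "'n::finite \<Rightarrow> nat mpoly"
  assumes "radical_curve_parametrization \<kappa> m F \<delta> e g p q"
    and "\<And>i. normal_form m e g (p i) = p i"
    and "\<And>i. normal_form m e g (q i) = q i"
    and "\<exists>i. \<not> guilty m e g (p i) \<and> deg m e g (p i) > deg m e g (q i)"
    and "\<And>i. ideal_gen (poly_ring m) (E_poly e g ` {1..m} \<union> {p i, q i}) = poly_ring m"
  shows "surjective_parametrization m e g p q"
proof -
  have g: "e i > 0" "g i \<noteq> 0" "vars (g i) \<subseteq> {..<i}" if "i \<in> {1..m}" for i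
    using assms(1) that
    by (auto simp: radical_curve_parametrization_def radical_tower_def poly_ring_def) fastforce
  have "tower_eval \<kappa> \<delta> 0 = 0"
    by (simp add: tower_eval_def eval_poly_def)
  then have pq: "vars (p i) \<subseteq> {..m}" "vars (q i) \<subseteq> {..m}" "q i \<noteq> 0" for i
    using assms(1) unfolding radical_curve_parametrization_def poly_ring_def by (blast, blast, metis)
  interpret nonzero_radical_equations e g m
    by unfold_locales (use g in auto)
  have ev_E: "ev a (E_poly e g i) = a i ^ e i - ev a (g i)" for a i
    by (simp add: E_poly_def ev.hom_minus ev.hom_power)
  \<comment> \<open>At a common zero of the generators, the representation of \<open>1\<close> in
    the ideal would give \<open>1 = 0\<close>.\<close>
  have no_common_zero: "ev a (q i) \<noteq> 0"
    if E: "\<And>j. j \<in> {1..m} \<Longrightarrow> ev a (E_poly e g j) = 0" and "ev a (p i) = 0" for a i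
  proof
    assume "ev a (q i) = 0"
    have "1 \<in> poly_ring m" by (auto simp: poly_ring_def vars_def)
    then obtain T c where T: "1 = (\<Sum>s\<in>T. c s * s)" "T \<subseteq> E_poly e g ` {1..m} \<union> {p i, q i}"
      using assms(5)[of i] unfolding ideal_gen_def by blast
    have "ev a s = 0" if "s \<in> T" for s
      using that T(2) E \<open>ev a (p i) = 0\<close> \<open>ev a (q i) = 0\<close> by auto
    with arg_cong[OF T(1), of "ev a"] show False
      by (simp add: ev.hom_sum ev.hom_mult)
  qed
  obtain i0 where i0: "\<not> guilty m e g (p i0)" "deg m e g (p i0) > deg m e g (q i0)"
    using assms(4) by blast
  obtain idx :: "'n \<Rightarrow> nat" where idx: "inj idx"
    using finite_imp_inj_to_nat_seg[of "UNIV :: 'n set"] by auto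
  \<comment> \<open>Indices beyond \<open>m\<close> are free; variable \<open>zv j\<close> stands
    for the coordinate \<open>x j\<close>.\<close>
  define zv where "zv j = Suc m + idx j" for j
  have zv: "inj zv" using idx by (auto simp: zv_def inj_def)
  define L where "L j = p j - Var (zv j) * q j" for j
  define M where "M s = (\<Sum>j\<in>UNIV. Const (s ^ idx j) * L j)" for s
  \<comment> \<open>Renames \<open>zv j\<close> to coordinate \<open>j\<close> of the target space.
    The default \<open>0\<close> at \<open>1..m\<close> is harmless, as \<open>fibre\<close> chooses
    those coordinates itself.\<close>
  define y :: "nat \<Rightarrow> 'n mpoly" where
    "y i = (if i \<in> range zv then Var (the_inv zv i) else 0)" for i
  \<comment> \<open>\<open>b x t\<close> is the point with first coordinate \<open>t\<close> and \<open>x\<close> in the additional variables.\<close>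
  define b where "b x t = (\<lambda>i. ev x (y i))(0 := t)" for x :: "'n \<Rightarrow> complex" and t
  have b_zv: "b x t (zv j) = x j" for x t j
    using the_inv_f_f[OF zv] by (simp add: b_def y_def) (simp add: zv_def)
  have b_0: "b x t 0 = t" for x t by (simp add: b_def)
  have ev_L: "ev a (L j) = ev a (p j) - a (zv j) * ev a (q j)" for a j
    by (simp add: L_def ev.hom_minus ev.hom_mult)
  have ev_M: "ev a (M s) = (\<Sum>j\<in>UNIV. s ^ idx j * ev a (L j))" for a s
    by (simp add: M_def ev.hom_sum ev.hom_mult)

  obtain N where N: "Poly_Mapping.lookup (R_poly e g m (L i0)) (Poly_Mapping.single 0 N) \<noteq> 0"
    "\<And>a. a \<in> Poly_Mapping.keys (R_poly e g m (L i0)) \<Longrightarrow>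
       Poly_Mapping.lookup a 0 < N \<or> a = Poly_Mapping.single 0 N"
    unfolding L_def using R_poly_top_monomial[of "p i0" "q i0" "zv i0"] pq i0
    by (auto simp: zv_def)
  let ?c = "Poly_Mapping.lookup (R_poly e g m (L i0)) (Poly_Mapping.single 0 N)"
  define P where "P = as_poly Const y (R_poly e g m (L i0))"
  define Q where "Q s = as_poly Const y (R_poly e g m (M s))" for s
  have cP: "coeff P N = Const ?c" "degree P \<le> N"
    unfolding P_def using coeff_as_poly[OF Const_hom N(2)] by auto
  with N(1) have "degree P = N" by (intro antisym le_degree) auto
  with cP have lP: "lead_coeff P = Const ?c" by simp
  have poly_P: "poly (map_poly (ev x) P) t = ev (b x t) (R_poly e g m (L i0))"
    and poly_Q: "poly (map_poly (ev x) (Q s)) t = ev (b x t) (R_poly e g m (M s))" for x t s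
    by (simp_all add: P_def Q_def map_poly_as_poly poly_as_poly b_def)

  \<comment> \<open>The root \<open>t\<close> may vary with \<open>s\<close>; the converse direction
    extracts a single point by finiteness.\<close>
  have image_iff: "x \<in> param_image m e g p q \<longleftrightarrow>
    (\<forall>s. \<exists>t. poly (map_poly (ev (vec_nth x)) P) t = 0 \<and>
       poly (map_poly (ev (vec_nth x)) (Q s)) t = 0)"
    for x :: "complex^'n"
  proof
    assume "x \<in> param_image m e g p q"
    then obtain a where a: "\<forall>i\<in>{1..m}. ev a (E_poly e g i) = 0"
      "\<forall>i. ev a (q i) \<noteq> 0" and x: "x = (\<chi> i. ev a (p i) / ev a (q i))"
      unfolding param_image_def by blast
    \<comment> \<open>Beyond \<open>m\<close> the values of \<open>a\<close> are arbitrary; here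
      they become the coordinates of \<open>x\<close>, which makes every \<open>L j\<close>
      vanish.\<close>
    define a' where "a' i = (if i \<le> m then a i else b (vec_nth x) (a 0) i)" for i
    have eq: "ev a' f = ev a f" if "vars f \<subseteq> {..m}" for f
      using that by (intro eval_poly_cong) (auto simp: a'_def)
    have "ev a' (L j) = 0" for j
    proof -
      have "a' (zv j) = vec_nth x j" using b_zv[of "vec_nth x" "a 0" j] by (simp add: a'_def zv_def)
      then show ?thesis using a(2) pq by (simp add: ev_L eq x)
    qed
    moreover have "a' \<in> fibre e g m (b (vec_nth x) (a 0))"
    proof -
      have "ev a' (g i) = ev a (g i)" if "i \<in> {1..m}" for i
        using g(3)[OF that] that by (intro eq) auto
      then show ?thesis
        using a(1) by (auto simp: fibre_def a'_def ev_E b_0 not_less_eq_eq)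
    qed
    ultimately show "\<forall>s. \<exists>t. poly (map_poly (ev (vec_nth x)) P) t = 0 \<and>
        poly (map_poly (ev (vec_nth x)) (Q s)) t = 0"
      unfolding poly_P poly_Q ev_R_poly_eq_0_iff[OF order.refl]
      by (intro allI exI[of _ "a 0"] conjI bexI[of _ a']) (simp_all add: ev_M)
  next
    assume common: "\<forall>s. \<exists>t. poly (map_poly (ev (vec_nth x)) P) t = 0 \<and>
      poly (map_poly (ev (vec_nth x)) (Q s)) t = 0"
    define T where "T = {t. poly (map_poly (ev (vec_nth x)) P) t = 0}"
    define A where "A = (\<Union>t\<in>T. fibre e g m (b (vec_nth x) t))"
    \<comment> \<open>The leading coefficient is constant and survives evaluation at every
      \<open>x\<close>, so only finitely many \<open>t\<close> are possible.\<close>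
    have "coeff (map_poly (ev (vec_nth x)) P) N \<noteq> 0"
      using cP N(1) by (simp add: coeff_map_poly)
    then have "map_poly (ev (vec_nth x)) P \<noteq> 0" by (metis coeff_0)
    then have "finite T" unfolding T_def by (rule poly_roots_finite)
    then have "finite A" unfolding A_def using finite_fibre by blast
    moreover have "\<exists>a\<in>A. (\<Sum>j\<in>UNIV. s ^ idx j * ev a (L j)) = 0" for s
    proof -
      obtain t where "t \<in> T" "ev (b (vec_nth x) t) (R_poly e g m (M s)) = 0"
        using common by (auto simp: T_def poly_Q)
      then show ?thesis
        unfolding A_def ev_R_poly_eq_0_iff[OF order.refl] ev_M by blast
    qed
    ultimately obtain a where a: "a \<in> A" "\<And>j. ev a (L j) = 0"
      using exists_zero_of_vanishing_combinations[OF _ idx, of A "\<lambda>a j. ev a (L j)"] by blast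
    then obtain t where t: "a \<in> fibre e g m (b (vec_nth x) t)" by (auto simp: A_def)
    have E: "ev a (E_poly e g i) = 0" if "i \<in> {1..m}" for i
      using t that by (simp add: fibre_def ev_E)
    have "a (zv j) = vec_nth x j" for j
      using t b_zv[of "vec_nth x" t j] by (simp add: fibre_def zv_def)
    then have px: "ev a (p j) = vec_nth x j * ev a (q j)" for j
      using a(2)[of j] by (simp add: ev_L)
    \<comment> \<open>If \<open>q j\<close> vanished at \<open>a\<close>, then by \<open>px\<close>
      so would \<open>p j\<close>.\<close>
    have "ev a (q j) \<noteq> 0" for j
      using no_common_zero[OF E, of j] px[of j] by auto
    with E px show "x \<in> param_image m e g p q"
      unfolding param_image_def by (intro CollectI exI[of _ a]) (auto simp: vec_eq_iff)
  qed
  have "\<exists>H. \<forall>s z. ev z (H s) = 0 \<longleftrightarrow>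
      (\<exists>t. poly (map_poly (ev z) P) t = 0 \<and> poly (map_poly (ev z) (Q s)) t = 0)"
    by (intro choice allI exists_eliminant[OF lP N(1)])
  then obtain H where H: "\<And>s z. ev z (H s) = 0 \<longleftrightarrow>
      (\<exists>t. poly (map_poly (ev z) P) t = 0 \<and> poly (map_poly (ev z) (Q s)) t = 0)"
    by blast
  \<comment> \<open>One equation for each complex \<open>s\<close>: the defining family may be
    infinite.\<close>
  have "param_image m e g p q = {x. \<forall>f\<in>range H. ev (vec_nth x) f = 0}"
    using image_iff H by auto
  then show ?thesis
    unfolding surjective_parametrization_def zariski_closed_def by blast
qed

end
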